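(* Consider the SDE in $\mathbb{R}^d$ $$dX(t)=A(X(t))dt+B(X(t))dW(t)+\int_UC_1(X(t-),u)N_1(du,dt)+\int_UC_2(X(t-),u)\hat N_2(du,dt),$$ and suppose that for any initial condition $x\in\mathbb{R}^d$ it has a unique solution, which is a strong Markov process. Let $\beta<1$ and assume that: (1) $A_{rad}(x)=a(x)r^\beta\varphi$, and for all $\varphi_0\in S^{d-1}$ the limit $\lim_{r\to+\infty,\ \varphi\to\varphi_0}a(x)=:\bar a(\varphi_0)$ exists, where $\bar a:S^{d-1}\to\mathbb{R}$ is a positive continuous function; (2) there exist $\gamma>0$, $C_{tan}>0$, $R_{tan}>0$ such that $\sup_{|y|=r}|A_{tan}(y)|\le C_{tan}r^{\beta-\gamma}$ for all $r>R_{tan}$; (3) for all $x$: $\mathrm{P}_x\big(\sup_{t\ge0}|X(t)|=+\infty\big)=1$; (4) there exists $\delta>0$ such that for every $\varepsilon>0$ there is $c=c_{\delta,\varepsilon}$ such that for all $x$ $$\mathrm{P}_x\Big(|\xi_X(t)|\le c\big(1+t^{\frac1{1-\beta}-\delta}\big),\ t\ge0\Big)\ge1-\varepsilon,$$ where $$\xi_X(t)=\int_0^tB(X(s))dW(s)+\int_0^t\int_UC_1(X(s-),u)N_1(du,ds)+\int_0^t\int_UC_2(X(s-),u)\hat N_2(du,ds).$$ Then for any initial condition $X(0)$ we have: (a) $\lim_{t\to\infty}|X(t)|=+\infty$ a.s.; (b) there exists a (random) limit $\varphi_X(+\infty):=\lim_{t\to\infty}\frac{X(t)}{|X(t)|}$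 a.s.; (c) $X(t)\sim\big((1-\beta)\,\bar a(\varphi_X(+\infty))\,t\big)^{\frac1{1-\beta}}\varphi_X(+\infty)$ as $t\to\infty$ a.s.
   Context: Here $W$ is a multi-dimensional Wiener process, $N_1$ is a Poisson point measure and $\hat N_2$ is a compensated Poisson point measure (the compensation of a Poisson point measure $N_2$), with intensities $dt\times\nu_1(du)$ and $dt\times\nu_2(du)$ respectively on $[0,\infty)\times U$; all integrals are assumed well-defined, and solutions are weak solutions. $\mathrm{P}_x$ is the law of the solution started at $X(0)=x$. Notation: $r=|x|$, $\varphi=x/|x|\in S^{d-1}$ (arbitrary direction if $x=0$); $A_{rad}(x)=\langle A(x),\varphi\rangle\varphi$, $A_{tan}(x)=A(x)-\langle A(x),\varphi\rangle\varphi$. For vector functions, $f(t)\sim g(t)$ as $t\to\infty$ means $|f(t)-g(t)|=o(|g(t)|)$. *)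

theory Defs
  imports "HOL-Probability.Probability" "HOL-Library.Landau_Symbols"
begin

section \<open>Paths\<close>

text \<open>Processes are functions of a real time; only times \<open>t \<ge> 0\<close> are ever constrained.\<close>

definition cadlag :: "(real \<Rightarrow> 'e::topological_space) \<Rightarrow> bool" where
  "cadlag f \<longleftrightarrow> (\<forall>t\<ge>0. (f \<longlongrightarrow> f t) (at_right t)) \<and> (\<forall>t>0. \<exists>l. (f \<longlongrightarrow> l) (at_left t))"

definition left_lim :: "(real \<Rightarrow> 'e::t2_space) \<Rightarrow> real \<Rightarrow> 'e" where
  "left_lim f t = Lim (at_left t) f"

definition path_space :: "(real \<Rightarrow> 'e::topological_space) measure" where
  "path_space = PiM {0..} (\<lambda>_. borel)"

definition vec_asymp :: "(real \<Rightarrow> 'e::real_normed_vector) \<Rightarrow> (real \<Rightarrow> 'e) \<Rightarrow> bool" where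
  "vec_asymp f g \<longleftrightarrow> (\<lambda>t. norm (f t - g t)) \<in> o[at_top](\<lambda>t. norm (g t))"

text \<open>The direction of \<open>x\<close> is \<open>sgn x = x /\<^sub>R norm x\<close>. At \<open>x = 0\<close> the library convention
  \<open>sgn 0 = 0\<close> replaces an arbitrary unit vector; no condition below depends on that value.\<close>

definition rad_part :: "('e::real_inner \<Rightarrow> 'e) \<Rightarrow> 'e \<Rightarrow> 'e" where
  "rad_part A x = (A x \<bullet> sgn x) *\<^sub>R sgn x"

definition tan_part :: "('e::real_inner \<Rightarrow> 'e) \<Rightarrow> 'e \<Rightarrow> 'e" where
  "tan_part A x = A x - (A x \<bullet> sgn x) *\<^sub>R sgn x"

section \<open>Stochastic bases and drivers\<close>

definition usual_basis :: "'w measure \<Rightarrow> (real \<Rightarrow> 'w measure) \<Rightarrow> bool" where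
  "usual_basis M F \<longleftrightarrow>
     prob_space M \<and> complete_measure M \<and>
     (\<forall>t\<ge>0. subalgebra M (F t) \<and> null_sets M \<subseteq> sets (F t)) \<and>
     (\<forall>s\<ge>0. \<forall>t\<ge>s. sets (F s) \<subseteq> sets (F t)) \<and>
     (\<forall>t\<ge>0. (\<Inter>s\<in>{t<..}. sets (F s)) \<subseteq> sets (F t))"

definition adapted :: "(real \<Rightarrow> 'w measure) \<Rightarrow> (real \<Rightarrow> 'w \<Rightarrow> 'e::topological_space) \<Rightarrow> bool" where
  "adapted F X \<longleftrightarrow> (\<forall>t\<ge>0. X t \<in> borel_measurable (F t))"

definition wiener_process :: "'w measure \<Rightarrow> (real \<Rightarrow> 'w \<Rightarrow> real ^ 'm) \<Rightarrow> bool" where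
  "wiener_process M W \<longleftrightarrow>
     (\<forall>t\<ge>0. W t \<in> borel_measurable M) \<and>
     (AE \<omega> in M. W 0 \<omega> = 0) \<and>
     (\<forall>\<omega>\<in>space M. continuous_on {0..} (\<lambda>t. W t \<omega>)) \<and>
     (\<forall>s\<ge>0. \<forall>t>s.
        prob_space.indep_vars M (\<lambda>_. borel) (\<lambda>i \<omega>. (W t \<omega> - W s \<omega>) $ i) UNIV \<and>
        (\<forall>i. distributed M lborel (\<lambda>\<omega>. (W t \<omega> - W s \<omega>) $ i) (normal_density 0 (sqrt (t - s))))) \<and>
     (\<forall>s\<ge>0. \<forall>t>s. prob_space.indep_set M
        (sigma_sets (space M) {W r -` A \<inter> space M | r A. 0 \<le> r \<and> r \<le> s \<and> A \<in> sets borel})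
        (sigma_sets (space M) {(\<lambda>\<omega>. W t \<omega> - W s \<omega>) -` A \<inter> space M | A. A \<in> sets borel}))"

definition time_intensity :: "'u measure \<Rightarrow> (real \<times> 'u) measure" where
  "time_intensity \<nu> = restrict_space lborel {0..} \<Otimes>\<^sub>M \<nu>"

text \<open>The formula for the law makes sense, and is the Dirac law at 0, for sets of intensity 0
  (here \<open>0 ^ 0 = 1\<close>). Sets of infinite intensity need no separate clause as \<open>\<nu>\<close> will be
  sigma-finite.\<close>

definition poisson_point_measure ::
    "'w measure \<Rightarrow> (real \<times> 'u) measure \<Rightarrow> ('w \<Rightarrow> (real \<times> 'u) measure) \<Rightarrow> bool" where
  "poisson_point_measure M \<mu> N \<longleftrightarrow>
     (\<forall>\<omega>\<in>space M. sets (N \<omega>) = sets \<mu>) \<and>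
     (\<forall>\<omega>\<in>space M. \<forall>E\<in>sets \<mu>. emeasure (N \<omega>) E \<in> \<nat> \<union> {\<infinity>}) \<and>
     (\<forall>E\<in>sets \<mu>. (\<lambda>\<omega>. emeasure (N \<omega>) E) \<in> borel_measurable M) \<and>
     (\<forall>E\<in>sets \<mu>. emeasure \<mu> E < \<infinity> \<longrightarrow> (\<forall>k::nat.
        measure M {\<omega>\<in>space M. emeasure (N \<omega>) E = of_nat k}
          = measure \<mu> E ^ k / fact k * exp (- measure \<mu> E))) \<and>
     (\<forall>(n::nat) E. (\<forall>i<n. E i \<in> sets \<mu>) \<and> disjoint_family_on E {..<n} \<longrightarrow>
        prob_space.indep_vars M (\<lambda>_. borel) (\<lambda>i \<omega>. emeasure (N \<omega>) (E i)) {..<n})"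

definition wiener_events :: "'w measure \<Rightarrow> (real \<Rightarrow> 'w \<Rightarrow> real ^ 'm) \<Rightarrow> real \<Rightarrow> 'w set set" where
  "wiener_events M W t =
     {(\<lambda>\<omega>. W s \<omega> - W t \<omega>) -` A \<inter> space M | s A. s \<ge> t \<and> A \<in> sets borel}"

definition point_events ::
    "'w measure \<Rightarrow> ('w \<Rightarrow> (real \<times> 'u) measure) \<Rightarrow> 'u measure \<Rightarrow> real set \<Rightarrow> 'w set set" where
  "point_events M N \<nu> T =
     {(\<lambda>\<omega>. emeasure (N \<omega>) E) -` A \<inter> space M | E A.
        E \<in> sets (time_intensity \<nu>) \<and> E \<subseteq> T \<times> space \<nu> \<and> A \<in> sets borel}"

text \<open>\<open>W\<close>, \<open>N1\<close>, \<open>N2\<close> are independent, adapted, and after time \<open>t\<close> independent of the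
  past \<open>F t\<close>.\<close>

definition drivers ::
    "'w measure \<Rightarrow> (real \<Rightarrow> 'w measure) \<Rightarrow> 'u measure \<Rightarrow> 'u measure \<Rightarrow> (real \<Rightarrow> 'w \<Rightarrow> real ^ 'm)
      \<Rightarrow> ('w \<Rightarrow> (real \<times> 'u) measure) \<Rightarrow> ('w \<Rightarrow> (real \<times> 'u) measure) \<Rightarrow> bool" where
  "drivers M F \<nu>1 \<nu>2 W N1 N2 \<longleftrightarrow>
     wiener_process M W \<and>
     poisson_point_measure M (time_intensity \<nu>1) N1 \<and>
     poisson_point_measure M (time_intensity \<nu>2) N2 \<and>
     prob_space.indep_sets M
       (\<lambda>i::nat. sigma_sets (space M)
          (if i = 0 then wiener_events M W 0
           else if i = 1 then point_events M N1 \<nu>1 {0..}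
           else point_events M N2 \<nu>2 {0..})) {0, 1, 2} \<and>
     adapted F W \<and>
     (\<forall>t\<ge>0. point_events M N1 \<nu>1 {0..t} \<union> point_events M N2 \<nu>2 {0..t} \<subseteq> sets (F t)) \<and>
     (\<forall>t\<ge>0. prob_space.indep_set M (sets (F t))
        (sigma_sets (space M)
          (wiener_events M W t \<union> point_events M N1 \<nu>1 {t<..} \<union> point_events M N2 \<nu>2 {t<..})))"

section \<open>Stochastic integrals\<close>

definition tendsto_in_prob ::
    "'w measure \<Rightarrow> (nat \<Rightarrow> 'w \<Rightarrow> 'e::metric_space) \<Rightarrow> ('w \<Rightarrow> 'e) \<Rightarrow> bool" where
  "tendsto_in_prob M f g \<longleftrightarrow>
     (\<forall>\<epsilon>>0. (\<lambda>n. measure M {\<omega>\<in>space M. dist (f n \<omega>) (g \<omega>) > \<epsilon>}) \<longlonglongrightarrow> 0)"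

text \<open>A triple \<open>(k, \<tau>, \<eta>)\<close> stands for the elementary integrand
  \<open>\<Sum>i<k. \<eta> i * indicator {\<tau> i<..\<tau> (Suc i)}\<close>.\<close>

type_synonym ('w, 'e) elem = "nat \<times> (nat \<Rightarrow> real) \<times> (nat \<Rightarrow> 'w \<Rightarrow> 'e)"

definition elementary :: "(real \<Rightarrow> 'w measure) \<Rightarrow> ('w, 'e::real_normed_vector) elem \<Rightarrow> bool" where
  "elementary F = (\<lambda>(k, \<tau>, \<eta>). 0 \<le> \<tau> 0 \<and> (\<forall>i<k. \<tau> i \<le> \<tau> (Suc i)) \<and>
     (\<forall>i<k. \<eta> i \<in> borel_measurable (F (\<tau> i)) \<and> (\<exists>b. \<forall>\<omega>\<in>space (F (\<tau> i)). norm (\<eta> i \<omega>) \<le> b)))"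

definition elem_process :: "('w, 'e::real_vector) elem \<Rightarrow> real \<Rightarrow> 'w \<Rightarrow> 'e" where
  "elem_process = (\<lambda>(k, \<tau>, \<eta>) t \<omega>. \<Sum>i<k. indicator {\<tau> i<..\<tau> (Suc i)} t *\<^sub>R \<eta> i \<omega>)"

definition elem_integral ::
    "(real \<Rightarrow> 'w \<Rightarrow> real ^ 'm) \<Rightarrow> ('w, real ^ 'm ^ 'd) elem \<Rightarrow> real \<Rightarrow> 'w \<Rightarrow> real ^ 'd" where
  "elem_integral W = (\<lambda>(k, \<tau>, \<eta>) t \<omega>.
     \<Sum>i<k. \<eta> i \<omega> *v (W (min t (\<tau> (Suc i))) \<omega> - W (min t (\<tau> i)) \<omega>))"

text \<open>\<open>I\<close> is (a version of) the Ito integral of \<open>H\<close> with respect to \<open>W\<close>. Continuity of \<open>I\<close> and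
  the limits at fixed times determine \<open>I\<close> up to indistinguishability.\<close>

definition is_ito_integral ::
    "'w measure \<Rightarrow> (real \<Rightarrow> 'w measure) \<Rightarrow> (real \<Rightarrow> 'w \<Rightarrow> real ^ 'm)
      \<Rightarrow> (real \<Rightarrow> 'w \<Rightarrow> real ^ 'm ^ 'd) \<Rightarrow> (real \<Rightarrow> 'w \<Rightarrow> real ^ 'd) \<Rightarrow> bool" where
  "is_ito_integral M F W H I \<longleftrightarrow>
     (AE \<omega> in M. \<forall>t\<ge>0. (\<integral>\<^sup>+ s\<in>{0..t}. ennreal ((norm (H s \<omega>))\<^sup>2) \<partial>lborel) < \<infinity>) \<and>
     adapted F I \<and> (AE \<omega> in M. continuous_on {0..} (\<lambda>t. I t \<omega>)) \<and>
     (\<exists>S. (\<forall>n::nat. elementary F (S n)) \<and>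
        (\<forall>t\<ge>0. \<forall>\<epsilon>>0. (\<lambda>n. measure M {\<omega>\<in>space M.
            (\<integral>\<^sup>+ s\<in>{0..t}. ennreal ((norm (elem_process (S n) s \<omega> - H s \<omega>))\<^sup>2) \<partial>lborel) > ennreal \<epsilon>})
          \<longlonglongrightarrow> 0) \<and>
        (\<forall>t\<ge>0. tendsto_in_prob M (\<lambda>n. elem_integral W (S n) t) (I t)))"

text \<open>\<open>J\<close> is (a version of) the integral of \<open>h\<close> with respect to the compensated measure
  \<open>N(du,ds) - ds \<nu>(du)\<close>. The integrability condition on \<open>min (norm h) ((norm h)\<^sup>2)\<close> is necessary
  and sufficient for the integral to exist as a local martingale, and covers both the locally
  square integrable and the locally integrable case. Under it, \<open>h\<close> cut off to \<open>norm h > 1/n\<close> is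
  integrable with respect to both \<open>N\<close> and \<open>ds \<nu>(du)\<close>, and \<open>J\<close> is the limit as \<open>n\<close> grows.
  Predictability of \<open>h\<close> is automatic for the integrands \<open>C(X(s-), u)\<close> used below.\<close>

definition is_compensated_integral ::
    "'w measure \<Rightarrow> (real \<Rightarrow> 'w measure) \<Rightarrow> 'u measure \<Rightarrow> ('w \<Rightarrow> (real \<times> 'u) measure)
      \<Rightarrow> ('w \<Rightarrow> real \<times> 'u \<Rightarrow> 'e::euclidean_space) \<Rightarrow> (real \<Rightarrow> 'w \<Rightarrow> 'e) \<Rightarrow> bool" where
  "is_compensated_integral M F \<nu> N h J \<longleftrightarrow>
     (AE \<omega> in M. \<forall>t\<ge>0.
        (\<integral>\<^sup>+ z\<in>{0<..t} \<times> space \<nu>. ennreal (min (norm (h \<omega> z)) ((norm (h \<omega> z))\<^sup>2)) \<partial>time_intensity \<nu>)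
          < \<infinity>) \<and>
     adapted F J \<and> (AE \<omega> in M. cadlag (\<lambda>t. J t \<omega>)) \<and>
     (\<forall>t\<ge>0. tendsto_in_prob M
        (\<lambda>n \<omega>. let E = {z\<in>{0<..t} \<times> space \<nu>. norm (h \<omega> z) > 1 / real (Suc n)} in
           (LINT z:E|N \<omega>. h \<omega> z) - (LINT z:E|time_intensity \<nu>. h \<omega> z))
        (J t))"

section \<open>The equation and its weak solutions\<close>

record ('d, 'm, 'u) sde =
  drift :: "real ^ 'd \<Rightarrow> real ^ 'd"
  diffusion :: "real ^ 'd \<Rightarrow> real ^ 'm ^ 'd"
  jump1 :: "real ^ 'd \<Rightarrow> 'u \<Rightarrow> real ^ 'd"
  jump2 :: "real ^ 'd \<Rightarrow> 'u \<Rightarrow> real ^ 'd"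
  intens1 :: "'u measure"
  intens2 :: "'u measure"

record ('w, 'd, 'm, 'u) sde_system =
  prb :: "'w measure"
  filt :: "real \<Rightarrow> 'w measure"
  wien :: "real \<Rightarrow> 'w \<Rightarrow> real ^ 'm"
  ppm1 :: "'w \<Rightarrow> (real \<times> 'u) measure"
  ppm2 :: "'w \<Rightarrow> (real \<times> 'u) measure"
  proc :: "real \<Rightarrow> 'w \<Rightarrow> real ^ 'd"

definition wf_sde :: "('d::finite, 'm::finite, 'u) sde \<Rightarrow> bool" where
  "wf_sde E \<longleftrightarrow>
     sigma_finite_measure (intens1 E) \<and> sigma_finite_measure (intens2 E) \<and>
     sets (intens1 E) = sets (intens2 E) \<and>
     drift E \<in> borel_measurable borel \<and> diffusion E \<in> borel_measurable borel \<and>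
     (\<lambda>(x, u). jump1 E x u) \<in> borel_measurable (borel \<Otimes>\<^sub>M intens1 E) \<and>
     (\<lambda>(x, u). jump2 E x u) \<in> borel_measurable (borel \<Otimes>\<^sub>M intens2 E)"

text \<open>\<open>\<xi>\<close> is the process \<open>\<xi>_X\<close>, the sum of the three stochastic integrals. The integral with
  respect to \<open>N1\<close> is a pathwise Lebesgue integral.\<close>

definition noise_part ::
    "('d::finite, 'm::finite, 'u) sde \<Rightarrow> ('w, 'd, 'm, 'u) sde_system \<Rightarrow> (real \<Rightarrow> 'w \<Rightarrow> real ^ 'd) \<Rightarrow> bool" where
  "noise_part E S \<xi> \<longleftrightarrow>
     (let X = proc S;
          h1 = (\<lambda>\<omega> (s, u). jump1 E (left_lim (\<lambda>r. X r \<omega>) s) u);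
          h2 = (\<lambda>\<omega> (s, u). jump2 E (left_lim (\<lambda>r. X r \<omega>) s) u)
      in \<exists>I J.
        is_ito_integral (prb S) (filt S) (wien S) (\<lambda>s \<omega>. diffusion E (X s \<omega>)) I \<and>
        is_compensated_integral (prb S) (filt S) (intens2 E) (ppm2 S) h2 J \<and>
        (AE \<omega> in prb S. \<forall>t\<ge>0.
           set_integrable (ppm1 S \<omega>) ({0<..t} \<times> space (intens1 E)) (h1 \<omega>) \<and>
           \<xi> t \<omega> = I t \<omega> + (LINT z:{0<..t} \<times> space (intens1 E)|ppm1 S \<omega>. h1 \<omega> z) + J t \<omega>))"

definition weak_solution :: "('d::finite, 'm::finite, 'u) sde \<Rightarrow> ('w, 'd, 'm, 'u) sde_system \<Rightarrow> bool" where
  "weak_solution E S \<longleftrightarrow>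
     usual_basis (prb S) (filt S) \<and>
     drivers (prb S) (filt S) (intens1 E) (intens2 E) (wien S) (ppm1 S) (ppm2 S) \<and>
     adapted (filt S) (proc S) \<and>
     (\<forall>\<omega>\<in>space (prb S). cadlag (\<lambda>t. proc S t \<omega>)) \<and>
     (\<exists>\<xi>. noise_part E S \<xi> \<and>
        (AE \<omega> in prb S. \<forall>t\<ge>0.
           set_integrable lborel {0..t} (\<lambda>s. drift E (proc S s \<omega>)) \<and>
           proc S t \<omega> = proc S 0 \<omega> + (LINT s:{0..t}|lborel. drift E (proc S s \<omega>)) + \<xi> t \<omega>))"

definition starts_at :: "('w, 'd::finite, 'm::finite, 'u) sde_system \<Rightarrow> real ^ 'd \<Rightarrow> bool" where
  "starts_at S x \<longleftrightarrow> (AE \<omega> in prb S. proc S 0 \<omega> = x)"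

definition path_law :: "('w, 'd::finite, 'm::finite, 'u) sde_system \<Rightarrow> (real \<Rightarrow> real ^ 'd) measure" where
  "path_law S = distr (prb S) path_space (\<lambda>\<omega>. \<lambda>t\<in>{0..}. proc S t \<omega>)"

text \<open>Existence and uniqueness in law for every starting point; \<open>P x\<close> is the law of the solution
  started at \<open>x\<close>. The type \<open>'w\<close> of the sample spaces is that of the dummy argument.\<close>

definition weakly_well_posed ::
    "'w itself \<Rightarrow> ('d::finite, 'm::finite, 'u) sde \<Rightarrow> (real ^ 'd \<Rightarrow> (real \<Rightarrow> real ^ 'd) measure) \<Rightarrow> bool" where
  "weakly_well_posed TYPE('w) E P \<longleftrightarrow>
     (\<forall>x. (\<exists>S :: ('w, 'd, 'm, 'u) sde_system. weak_solution E S \<and> starts_at S x) \<and>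
          (\<forall>S :: ('w, 'd, 'm, 'u) sde_system. weak_solution E S \<and> starts_at S x \<longrightarrow> path_law S = P x))"

section \<open>The strong Markov property\<close>

definition natural_events :: "'w measure \<Rightarrow> (real \<Rightarrow> 'w \<Rightarrow> 'e::topological_space) \<Rightarrow> real \<Rightarrow> 'w set set" where
  "natural_events M X t =
     (\<Inter>s\<in>{t<..}. sigma_sets (space M) {X r -` A \<inter> space M | r A. 0 \<le> r \<and> r \<le> s \<and> A \<in> sets borel})"

text \<open>The Markov property with transition laws \<open>P\<close> at all stopping times of the
  right-continuous natural filtration. The last equation says that on \<open>\<tau> < \<infinity>\<close> the conditional
  probability of \<open>X(\<tau> + \<cdot>) \<in> B\<close> given the events up to \<open>\<tau>\<close> is \<open>P (X \<tau>) B\<close>.\<close>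

definition strong_markov ::
    "(real ^ 'd::finite \<Rightarrow> (real \<Rightarrow> real ^ 'd) measure) \<Rightarrow> ('w, 'd, 'm::finite, 'u) sde_system \<Rightarrow> bool" where
  "strong_markov P S \<longleftrightarrow>
     (let M = prb S; X = proc S; G = natural_events M X in
        P \<in> borel \<rightarrow>\<^sub>M prob_algebra path_space \<and>
        (\<forall>\<tau> :: 'w \<Rightarrow> ereal.
           (\<forall>\<omega>\<in>space M. 0 \<le> \<tau> \<omega>) \<and> (\<forall>t\<ge>0. {\<omega>\<in>space M. \<tau> \<omega> \<le> ereal t} \<in> G t) \<longrightarrow>
           (\<forall>D\<in>sets M. (\<forall>t\<ge>0. D \<inter> {\<omega>\<in>space M. \<tau> \<omega> \<le> ereal t} \<in> G t) \<and> (\<forall>\<omega>\<in>D. \<tau> \<omega> < \<infinity>) \<longrightarrow>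
              (\<forall>B\<in>sets path_space.
                 measure M {\<omega>\<in>D. (\<lambda>t\<in>{0..}. X (real_of_ereal (\<tau> \<omega>) + t) \<omega>) \<in> B}
                   = (LINT \<omega>:D|M. measure (P (X (real_of_ereal (\<tau> \<omega>)) \<omega>)) B)))))"

end

theory Submission
  imports Defs "HOL-Real_Asymp.Real_Asymp"
begin

text \<open>Let \<open>x\<close> be a path and \<open>y = x - \<xi>\<close>, so that \<open>y' = A(x)\<close> almost everywhere. As long as the noise is small compared to
  \<open>y\<close>, the drift is close to \<open>abar(y/|y|) |y|\<^sup>\<beta> y/|y|\<close>, hence \<open>|y|\<close> to the power \<open>1 - \<beta>\<close> grows linearly and
  \<open>|y|\<close> like \<open>t\<close> to the power \<open>p = 1/(1 - \<beta>)\<close>. A noise of order \<open>t\<^sup>q\<close> with \<open>q < p\<close> therefore never catches up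
  if \<open>|x 0|\<close> is large enough. The component of \<open>A(x)\<close> orthogonal to \<open>y\<close> comes only from the tangential
  drift and the noise, so that the direction of \<open>y\<close> moves with speed of order \<open>t\<close> to the power \<open>-1 - \<rho>\<close>, \<open>\<rho> > 0\<close>,
  and converges; then \<open>abar\<close> may be frozen at the limit, which gives the exact growth rate.

  So from far away starting points the asymptotics hold with probability at least \<open>1 - \<epsilon>\<close>. They are
  invariant under time shifts, and the process leaves every ball, so the strong Markov property at
  the exit times shows that they hold with probability at least \<open>1 - \<epsilon>\<close> for every starting point and every \<open>\<epsilon>\<close>.\<close>

text \<open>Two obstacles shape the deterministic half. The drift acts at \<open>x\<close>, which
  may jump, and \<open>a\<close> is known only in the limit. So every estimate is attached to the
  continuous \<open>y\<close>, with the drift evaluated at \<open>y + z\<close> for small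
  \<open>z\<close>, and compactness of the sphere makes the limit of \<open>a\<close> uniform in the
  direction. Taking the power 1 - \<beta> turns the speed \<mu> r^\<beta> into the constant speed (1
  - \<beta>) \<mu>; each comparison keeps a strict gap between two such constants, since only local
  bounds on increments to the right are available.

  In the probabilistic half, the bound on the noise refers to the clock of one solution and is not
  itself carried through the Markov property. What is transferred is the convergence of X(t)/t^p to
  a point of a compact set that avoids 0: it yields all three claims and can be tested at countably
  many times. The radius beyond which a starting point counts as far depends on the noise bound but
  not on the path, which makes the probability 1 - \<epsilon> uniform over far starting
  points.\<close>

section \<open>Comparison of continuous functions by their right increments\<close>

lemma right_nondecreasing_imp_le:
  fixes h :: "real \<Rightarrow> real"
  assumes "a \<le> b" and cont: "continuous_on {a..b} h"
    and inc: "\<And>t. a \<le> t \<Longrightarrow> t < b \<Longrightarrow> eventually (\<lambda>s. h t \<le> h s) (at_right t)"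
  shows "h a \<le> h b"
proof -
  define S where "S = {t\<in>{a..b}. h a \<le> h t}"
  have "closed S"
    unfolding S_def by (intro continuous_on_closed_Collect_le continuous_on_const cont) auto
  moreover have "a \<in> S" "bdd_above S"
    using \<open>a \<le> b\<close> by (auto simp: S_def intro!: bdd_aboveI[of _ b])
  ultimately have sup: "Sup S \<in> S"
    by (intro closed_contains_Sup) auto
  define c where "c = Sup S"
  have c: "a \<le> c" "c \<le> b" "h a \<le> h c"
    using sup by (auto simp: S_def c_def)
  have "c = b"
  proof (rule ccontr)
    assume "c \<noteq> b"
    with c have "c < b" by simp
    from inc[OF c(1) this] obtain d where d: "d > c" "\<And>s. c < s \<Longrightarrow> s < d \<Longrightarrow> h c \<le> h s"
      unfolding eventually_at_right_field by blast
    define s where "s = min b ((c + d) / 2)"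
    have s: "c < s" "s < d" "s \<le> b"
      using d \<open>c < b\<close> by (auto simp: s_def min_def)
    have "s \<in> S" using d(2)[OF s(1,2)] c s by (auto simp: S_def)
    then have "s \<le> c" unfolding c_def using \<open>bdd_above S\<close> by (rule cSup_upper)
    with s show False by simp
  qed
  with c show ?thesis by simp
qed

text \<open>A mean value inequality without derivatives: by the triangle inequality
  \<open>G t - norm (F t - F a)\<close> satisfies the local condition of the previous lemma.\<close>

lemma norm_diff_le_right_increments:
  fixes F :: "real \<Rightarrow> 'e::real_normed_vector" and G :: "real \<Rightarrow> real"
  assumes "a \<le> b" and contF: "continuous_on {a..b} F" and contG: "continuous_on {a..b} G"
    and inc: "\<And>t. a \<le> t \<Longrightarrow> t < b \<Longrightarrow> eventually (\<lambda>s. norm (F s - F t) \<le> G s - G t) (at_right t)"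
  shows "norm (F b - F a) \<le> G b - G a"
proof -
  define h where "h t = G t - norm (F t - F a)" for t
  have "h a \<le> h b"
  proof (rule right_nondecreasing_imp_le[OF \<open>a \<le> b\<close>])
    show "continuous_on {a..b} h"
      unfolding h_def by (intro continuous_intros contF contG)
  next
    fix t assume "a \<le> t" "t < b"
    show "eventually (\<lambda>s. h t \<le> h s) (at_right t)"
      using inc[OF \<open>a \<le> t\<close> \<open>t < b\<close>]
    proof eventually_elim
      case (elim s)
      have "norm (F s - F a) \<le> norm (F s - F t) + norm (F t - F a)"
        using norm_triangle_ineq[of "F s - F t" "F t - F a"] by simp
      with elim show ?case by (simp add: h_def)
    qed
  qed
  then show ?thesis by (simp add: h_def)
qed

lemma eventually_at_right_Icc:
  fixes t :: real
  assumes "P t" "eventually P (at_right t)"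
  shows "eventually (\<lambda>s. \<forall>r\<in>{t..s}. P r) (at_right t)"
proof -
  obtain d where "d > t" "\<And>s. t < s \<Longrightarrow> s < d \<Longrightarrow> P s"
    using assms(2) unfolding eventually_at_right_field by blast
  then show ?thesis
    using assms(1) unfolding eventually_at_right_field
    by (metis atLeastAtMost_iff dual_order.strict_trans2 order_le_less le_less_trans)
qed

text \<open>With x = y + z, the vector |y| (sgn x - sgn y) equals (|y| - |x|) sgn x + z, and both
  summands have norm at most |z|. The identity survives x = 0 because
  \<open>sgn 0 = 0\<close>.\<close>

lemma norm_sgn_add_diff_le:
  fixes y z :: "'e::real_normed_vector"
  assumes "y \<noteq> 0"
  shows "norm (sgn (y + z) - sgn y) \<le> 2 * norm z / norm y"
proof -
  define x where "x = y + z"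
  have z: "z = x - y" by (simp add: x_def)
  have eq: "norm y *\<^sub>R (sgn x - sgn y) = (norm y - norm x) *\<^sub>R sgn x + z"
    using assms unfolding z by (cases "x = 0") (auto simp: sgn_div_norm algebra_simps)
  have "norm y * norm (sgn x - sgn y) = norm ((norm y - norm x) *\<^sub>R sgn x + z)"
    unfolding eq[symmetric] by simp
  also have "\<dots> \<le> \<bar>norm y - norm x\<bar> * norm (sgn x) + norm z"
    by (metis norm_scaleR norm_triangle_ineq)
  also have "\<dots> \<le> \<bar>norm y - norm x\<bar> * 1 + norm z"
    by (intro add_mono mult_left_mono) (auto simp: norm_sgn)
  also have "\<bar>norm y - norm x\<bar> \<le> norm z"
    unfolding x_def using norm_triangle_ineq3[of y "y + z"] by simp
  finally show ?thesis
    using assms by (simp add: x_def field_simps)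
qed

text \<open>The power 1 - b linearises the growth law r' = \<mu> r^b: the derivative at
  \<open>t\<close> of the left-hand power is exactly (1 - b) \<mu>, and the strict gap to \<kappa>
  absorbs the higher order terms. Positivity of the base is part of the claim because \<mu> may be
  negative, and monotonicity of powers is applied to this base later.\<close>

lemma powr_increment_ge:
  fixes r b \<mu> \<kappa> t :: real
  assumes "r > 0" "\<kappa> < (1 - b) * \<mu>"
  shows "eventually (\<lambda>s. r + \<mu> * r powr b * (s - t) > 0 \<and>
           (r + \<mu> * r powr b * (s - t)) powr (1 - b) \<ge> r powr (1 - b) + \<kappa> * (s - t)) (at_right t)"
proof -
  define v where "v s = r + \<mu> * r powr b * (s - t)" for s
  define g where "g s = v s powr (1 - b) - \<kappa> * (s - t)" for s
  have vt: "v t = r" by (simp add: v_def)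
  have "isCont v t" unfolding v_def by (intro continuous_intros)
  then have ev: "eventually (\<lambda>s. v s > 0) (at_right t)"
    using order_tendstoD(1)[of v "v t" "at_right t" 0] assms vt
    by (metis filterlim_at_split isCont_def)
  have eq: "r powr (1 - b - 1) * r powr b = 1"
    using assms by (simp add: powr_add[symmetric])
  have lin: "((\<lambda>s. \<kappa> * (s - t)) has_real_derivative \<kappa>) (at t)"
    by (auto intro!: derivative_eq_intros)
  have dv: "(v has_real_derivative \<mu> * r powr b) (at t)"
    unfolding v_def by (auto intro!: derivative_eq_intros)
  have "((\<lambda>s. v s powr (1 - b)) has_real_derivative (1 - b) * r powr (1 - b - 1) * (\<mu> * r powr b)) (at t)"
    using DERIV_fun_powr[OF dv, of "1 - b"] assms vt by (simp add: mult_ac)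
  then have dg0: "(g has_real_derivative (1 - b) * r powr (1 - b - 1) * (\<mu> * r powr b) - \<kappa>) (at t)"
    unfolding g_def by (rule DERIV_diff[OF _ lin])
  have "(1 - b) * r powr (1 - b - 1) * (\<mu> * r powr b) = (1 - b) * \<mu> * (r powr (1 - b - 1) * r powr b)"
    by (simp only: mult_ac)
  then have eq2: "(1 - b) * r powr (1 - b - 1) * (\<mu> * r powr b) = (1 - b) * \<mu>"
    by (simp only: eq mult_1_right)
  have dg: "(g has_real_derivative (1 - b) * \<mu> - \<kappa>) (at t)"
    using dg0 by (simp only: eq2)
  obtain d where d: "d > 0" "\<And>h. h > 0 \<Longrightarrow> h < d \<Longrightarrow> g t < g (t + h)"
    using DERIV_pos_inc_right[OF dg] assms by auto
  have "eventually (\<lambda>s. g t \<le> g s) (at_right t)"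
    unfolding eventually_at_right_field
  proof (intro exI conjI allI impI)
    show "t < t + d" using d by simp
    fix s assume "t < s" "s < t + d"
    then show "g t \<le> g s" using d(2)[of "s - t"] by simp
  qed
  with ev show ?thesis
  proof eventually_elim
    case (elim s)
    then show ?case by (simp add: g_def v_def)
  qed
qed

lemma powr_increment_le:
  fixes r b \<mu> \<kappa> t :: real
  assumes "r > 0" "\<kappa> > (1 - b) * \<mu>"
  shows "eventually (\<lambda>s. (r + \<mu> * r powr b * (s - t)) powr (1 - b) \<le> r powr (1 - b) + \<kappa> * (s - t)) (at_right t)"
proof -
  define v where "v s = r + \<mu> * r powr b * (s - t)" for s
  define g where "g s = \<kappa> * (s - t) - v s powr (1 - b)" for s
  have vt: "v t = r" by (simp add: v_def)
  have eq: "r powr (1 - b - 1) * r powr b = 1"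
    using assms by (simp add: powr_add[symmetric])
  have lin: "((\<lambda>s. \<kappa> * (s - t)) has_real_derivative \<kappa>) (at t)"
    by (auto intro!: derivative_eq_intros)
  have dv: "(v has_real_derivative \<mu> * r powr b) (at t)"
    unfolding v_def by (auto intro!: derivative_eq_intros)
  have "((\<lambda>s. v s powr (1 - b)) has_real_derivative (1 - b) * r powr (1 - b - 1) * (\<mu> * r powr b)) (at t)"
    using DERIV_fun_powr[OF dv, of "1 - b"] assms vt by (simp add: mult_ac)
  then have dg0: "(g has_real_derivative \<kappa> - (1 - b) * r powr (1 - b - 1) * (\<mu> * r powr b)) (at t)"
    unfolding g_def by (rule DERIV_diff[OF lin])
  have "(1 - b) * r powr (1 - b - 1) * (\<mu> * r powr b) = (1 - b) * \<mu> * (r powr (1 - b - 1) * r powr b)"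
    by (simp only: mult_ac)
  then have eq2: "(1 - b) * r powr (1 - b - 1) * (\<mu> * r powr b) = (1 - b) * \<mu>"
    by (simp only: eq mult_1_right)
  have dg: "(g has_real_derivative \<kappa> - (1 - b) * \<mu>) (at t)"
    using dg0 by (simp only: eq2)
  obtain d where d: "d > 0" "\<And>h. h > 0 \<Longrightarrow> h < d \<Longrightarrow> g t < g (t + h)"
    using DERIV_pos_inc_right[OF dg] assms by auto
  show ?thesis
    unfolding eventually_at_right_field
  proof (intro exI conjI allI impI)
    show "t < t + d" using d by simp
    fix s assume "t < s" "s < t + d"
    then have "g t \<le> g s" using d(2)[of "s - t"] by simp
    then show "(r + \<mu> * r powr b * (s - t)) powr (1 - b) \<le> r powr (1 - b) + \<kappa> * (s - t)"
      by (simp add: g_def v_def)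
  qed
qed

section \<open>The drift far from the origin\<close>

locale radial_drift =
  fixes A :: "'e::euclidean_space \<Rightarrow> 'e" and a abar :: "'e \<Rightarrow> real" and \<beta> \<gamma> C\<^sub>0 R\<^sub>0 :: real
  assumes beta: "\<beta> < 1"
    and radial: "\<And>x. rad_part A x = (a x * norm x powr \<beta>) *\<^sub>R sgn x"
    and radial_limit: "\<And>\<phi>. \<phi> \<in> sphere 0 1 \<Longrightarrow>
          (a \<longlongrightarrow> abar \<phi>) (inf (filtercomap norm at_top) (filtercomap sgn (nhds \<phi>)))"
    and abar_cont: "continuous_on (sphere 0 1) abar"
    and abar_pos: "\<And>\<phi>. \<phi> \<in> sphere 0 1 \<Longrightarrow> abar \<phi> > 0"
    and gamma: "\<gamma> > 0"
    and tangential: "\<And>x. norm x > R\<^sub>0 \<Longrightarrow> norm (tan_part A x) \<le> C\<^sub>0 * norm x powr (\<beta> - \<gamma>)"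
begin

lemma drift_decomp: "A x = (a x * norm x powr \<beta>) *\<^sub>R sgn x + tan_part A x"
  unfolding radial[symmetric] by (simp add: rad_part_def tan_part_def)

lemma tendsto_radial:
  fixes xs :: "nat \<Rightarrow> 'e"
  assumes "filterlim (\<lambda>n. norm (xs n)) at_top sequentially" "(\<lambda>n. sgn (xs n)) \<longlonglongrightarrow> \<phi>" "\<phi> \<in> sphere 0 1"
  shows "(\<lambda>n. a (xs n)) \<longlonglongrightarrow> abar \<phi>"
proof (rule filterlim_compose[OF radial_limit[OF assms(3)]])
  show "filterlim xs (inf (filtercomap norm at_top) (filtercomap sgn (nhds \<phi>))) sequentially"
    using assms by (auto simp: filterlim_inf filterlim_filtercomap_iff o_def)
qed

text \<open>A compactness argument. Along counterexamples running off to infinity the directions of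
  \<open>y\<close> converge on a subsequence; perturbations that are small relative to |y| change
  neither the limiting direction nor the ratio of the norms, so the limit of \<open>a\<close>, the
  continuity of \<open>abar\<close> and the decay of the tangential part give a contradiction. The
  perturbation \<open>z\<close> is included since the drift is taken at \<open>x\<close> but
  compared with the direction of \<open>y\<close>.\<close>

lemma drift_approx:
  assumes "\<epsilon> > 0"
  obtains \<eta> R where "\<eta> > 0" "R > 0" "\<eta> \<le> 1/2"
    "\<And>y z. norm y \<ge> R \<Longrightarrow> norm z \<le> \<eta> * norm y \<Longrightarrow>
       norm (A (y + z) - (abar (sgn y) * norm y powr \<beta>) *\<^sub>R sgn y) \<le> \<epsilon> * norm y powr \<beta>"
proof -
  \<comment> \<open>One number serves for both thresholds, so that failure for every n produces
    sequences with |y n| tending to infinity and |z n| / |y n| tending to 0. The denominator n + 2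
    gives \<eta> \<le> 1/2.\<close>
  have "\<exists>n::nat. \<forall>y z. norm y \<ge> real n + 1 \<longrightarrow> norm z \<le> norm y / (real n + 2) \<longrightarrow>
       norm (A (y + z) - (abar (sgn y) * norm y powr \<beta>) *\<^sub>R sgn y) \<le> \<epsilon> * norm y powr \<beta>"
  proof (rule ccontr)
    assume "\<not> ?thesis"
    then obtain y z where y: "\<And>n. norm (y n) \<ge> real n + 1"
      and z: "\<And>n::nat. norm (z n) \<le> norm (y n) / (real n + 2)"
      and bad: "\<And>n::nat. norm (A (y n + z n) - (abar (sgn (y n)) * norm (y n) powr \<beta>) *\<^sub>R sgn (y n))
                 > \<epsilon> * norm (y n) powr \<beta>"
      unfolding not_ex not_all not_imp not_le by metis
    have y0: "norm (y n) > 0" "y n \<noteq> 0" for n using y[of n] by auto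
    have sph: "sgn (y n) \<in> sphere 0 1" for n using y0 by (simp add: norm_sgn)
    obtain \<phi> \<sigma> where phi: "\<phi> \<in> sphere 0 1" "strict_mono \<sigma>" "((\<lambda>n. sgn (y n)) \<circ> \<sigma>) \<longlonglongrightarrow> \<phi>"
      using compact_sphere[of "0::'e" 1] sph unfolding compact_def by metis
    define u w where "u n = y (\<sigma> n)" and "w n = z (\<sigma> n)" for n
    have u0: "norm (u n) > 0" "u n \<noteq> 0" for n using y0 by (auto simp: u_def)
    have sgu: "(\<lambda>n. sgn (u n)) \<longlonglongrightarrow> \<phi>" using phi(3) by (simp add: u_def o_def)
    have ulim: "filterlim (\<lambda>n. norm (u n)) at_top sequentially"
    proof (rule filterlim_at_top_mono)
      show "filterlim real at_top sequentially" by (rule filterlim_real_sequentially)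
      show "eventually (\<lambda>n. real n \<le> norm (u n)) sequentially"
        using y seq_suble[OF phi(2)] by (intro always_eventually allI) (smt (verit) u_def of_nat_mono)
    qed
    have wu: "(\<lambda>n. norm (w n) / norm (u n)) \<longlonglongrightarrow> 0"
    proof (rule tendsto_sandwich[of "\<lambda>_. 0"])
      show "eventually (\<lambda>n. norm (w n) / norm (u n) \<le> 1 / (real n + 2)) sequentially"
      proof (intro always_eventually allI)
        fix n
        have "norm (w n) / norm (u n) \<le> 1 / (real (\<sigma> n) + 2)"
          using z[of "\<sigma> n"] u0[of n] by (simp add: u_def w_def field_simps)
        also have "\<dots> \<le> 1 / (real n + 2)"
          using seq_suble[OF phi(2), of n] by (intro divide_left_mono) auto
        finally show "norm (w n) / norm (u n) \<le> 1 / (real n + 2)" .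
      qed
      show "(\<lambda>n. 1 / (real n + 2)) \<longlonglongrightarrow> 0" by real_asymp
    qed auto
    define x where "x n = u n + w n" for n
    have "(\<lambda>n. sgn (x n) - sgn (u n)) \<longlonglongrightarrow> 0"
    proof (rule Lim_null_comparison)
      show "eventually (\<lambda>n. norm (sgn (x n) - sgn (u n)) \<le> 2 * (norm (w n) / norm (u n))) sequentially"
        using norm_sgn_add_diff_le[OF u0(2)] by (auto simp: x_def)
      show "(\<lambda>n. 2 * (norm (w n) / norm (u n))) \<longlonglongrightarrow> 0"
        using tendsto_mult_right_zero[OF wu] by simp
    qed
    from tendsto_add[OF this sgu] have sgx: "(\<lambda>n. sgn (x n)) \<longlonglongrightarrow> \<phi>" by simp
    have "(\<lambda>n. norm (x n) / norm (u n) - 1) \<longlonglongrightarrow> 0"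
    proof (rule Lim_null_comparison[OF _ wu], intro always_eventually allI)
      fix n
      have "norm (x n) / norm (u n) - 1 = (norm (x n) - norm (u n)) / norm (u n)"
        using u0[of n] by (simp add: diff_divide_distrib)
      then have "norm (norm (x n) / norm (u n) - 1) = \<bar>norm (x n) - norm (u n)\<bar> / norm (u n)"
        by (simp only: real_norm_def abs_divide abs_norm_cancel)
      also have "\<dots> \<le> norm (w n) / norm (u n)"
        using norm_triangle_ineq3[of "x n" "u n"] by (intro divide_right_mono) (auto simp: x_def)
      finally show "norm (norm (x n) / norm (u n) - 1) \<le> norm (w n) / norm (u n)" .
    qed
    from tendsto_add[OF this tendsto_const[of 1]]
    have rat: "(\<lambda>n. norm (x n) / norm (u n)) \<longlonglongrightarrow> 1" by simp
    have xlim: "filterlim (\<lambda>n. norm (x n)) at_top sequentially"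
      using filterlim_tendsto_pos_mult_at_top[OF rat _ ulim] u0 by simp
    have alim: "(\<lambda>n. a (x n)) \<longlonglongrightarrow> abar \<phi>"
      by (rule tendsto_radial[OF xlim sgx phi(1)])
    have ablim: "(\<lambda>n. abar (sgn (u n))) \<longlonglongrightarrow> abar \<phi>"
      using continuous_on_tendsto_compose[OF abar_cont sgu phi(1)] sph by (simp add: u_def)
    have pw: "(\<lambda>n. (norm (x n) / norm (u n)) powr \<beta>) \<longlonglongrightarrow> 1"
      using tendsto_powr[OF rat tendsto_const[of \<beta>]] by simp
    have tan0: "(\<lambda>n. tan_part A (x n) /\<^sub>R norm (u n) powr \<beta>) \<longlonglongrightarrow> 0"
    proof (rule Lim_null_comparison)
      show "eventually (\<lambda>n. norm (tan_part A (x n) /\<^sub>R norm (u n) powr \<beta>)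
            \<le> C\<^sub>0 * ((norm (x n) / norm (u n)) powr \<beta> * norm (x n) powr (-\<gamma>))) sequentially"
        using filterlim_at_top_dense[THEN iffD1, OF xlim, rule_format, of "max R\<^sub>0 0"]
      proof eventually_elim
        case (elim n)
        have "norm (tan_part A (x n) /\<^sub>R norm (u n) powr \<beta>) = norm (tan_part A (x n)) / norm (u n) powr \<beta>"
          by (simp add: divide_inverse mult.commute)
        also have "\<dots> \<le> C\<^sub>0 * norm (x n) powr (\<beta> - \<gamma>) / norm (u n) powr \<beta>"
          using tangential[of "x n"] elim by (intro divide_right_mono) auto
        also have "\<dots> = C\<^sub>0 * ((norm (x n) / norm (u n)) powr \<beta> * norm (x n) powr (-\<gamma>))"
          using elim u0[of n] by (simp add: powr_divide powr_diff powr_minus field_simps)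
        finally show ?case .
      qed
      have "(\<lambda>n. norm (x n) powr (-\<gamma>)) \<longlonglongrightarrow> 0"
        by (rule tendsto_neg_powr[OF _ xlim]) (use gamma in simp)
      from tendsto_mult[OF tendsto_const[of C\<^sub>0] tendsto_mult[OF pw this]]
      show "(\<lambda>n. C\<^sub>0 * ((norm (x n) / norm (u n)) powr \<beta> * norm (x n) powr (-\<gamma>))) \<longlonglongrightarrow> 0" by simp
    qed
    \<comment> \<open>The error of the approximation at the n-th counterexample, divided by |u
      n|^\<beta>. It tends to 0, although each counterexample keeps its norm above
      \<epsilon>.\<close>
    define D where "D n = (a (x n) * (norm (x n) / norm (u n)) powr \<beta>) *\<^sub>R sgn (x n)
        + tan_part A (x n) /\<^sub>R norm (u n) powr \<beta> - abar (sgn (u n)) *\<^sub>R sgn (u n)" for n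
    have "D \<longlonglongrightarrow> (abar \<phi> * 1) *\<^sub>R \<phi> + 0 - abar \<phi> *\<^sub>R \<phi>"
      unfolding D_def by (intro tendsto_intros alim pw sgx tan0 ablim sgu)
    then have "D \<longlonglongrightarrow> 0" by simp
    then have "eventually (\<lambda>n. norm (D n) < \<epsilon>) sequentially"
      using \<open>\<epsilon> > 0\<close> by (metis order_tendstoD(2) tendsto_norm_zero)
    then obtain n where n: "norm (D n) < \<epsilon>"
      by (auto simp: eventually_sequentially)
    have "norm (u n) powr \<beta> *\<^sub>R D n = A (x n) - (abar (sgn (u n)) * norm (u n) powr \<beta>) *\<^sub>R sgn (u n)"
      using u0[of n] unfolding D_def drift_decomp[of "x n"]
      by (simp add: scaleR_diff_right scaleR_add_right powr_divide mult_ac)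
    then have "norm (A (x n) - (abar (sgn (u n)) * norm (u n) powr \<beta>) *\<^sub>R sgn (u n)) = norm (u n) powr \<beta> * norm (D n)"
      by (metis abs_of_nonneg norm_scaleR powr_ge_zero)
    also have "\<dots> \<le> \<epsilon> * norm (u n) powr \<beta>"
      by (subst mult.commute, rule mult_right_mono) (use n in auto)
    finally show False
      using bad[of "\<sigma> n"] by (simp add: u_def w_def x_def)
  qed
  then obtain n :: nat where n: "\<And>y z. norm y \<ge> real n + 1 \<Longrightarrow> norm z \<le> norm y / (real n + 2) \<Longrightarrow>
       norm (A (y + z) - (abar (sgn y) * norm y powr \<beta>) *\<^sub>R sgn y) \<le> \<epsilon> * norm y powr \<beta>"
    by blast
  show ?thesis
    by (rule that[of "1 / (real n + 2)" "real n + 1"]) (use n in \<open>auto simp: field_simps\<close>)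
qed

end

section \<open>Integral bounds on increments and the turning of directions\<close>

lemma has_integral_inner_ge:
  fixes f :: "real \<Rightarrow> 'e::euclidean_space"
  assumes f: "(f has_integral i) {s..t}" and "s \<le> t" and ge: "\<And>r. r \<in> {s..t} \<Longrightarrow> m \<le> f r \<bullet> e"
  shows "m * (t - s) \<le> i \<bullet> e"
proof -
  have "((\<lambda>r. f r \<bullet> e) has_integral (i \<bullet> e)) {s..t}"
    using has_integral_linear[OF f bounded_linear_inner_left[of e]] by (simp add: o_def)
  moreover have "((\<lambda>r. m) has_integral (m * (t - s))) {s..t}"
    using has_integral_const_real[of m s t] \<open>s \<le> t\<close> by (simp add: mult.commute)
  ultimately show ?thesis using ge by (auto intro: has_integral_le)
qed

lemma has_integral_norm_le:
  fixes f :: "real \<Rightarrow> 'e::euclidean_space"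
  assumes f: "(f has_integral i) {s..t}" and "s \<le> t" and le: "\<And>r. r \<in> {s..t} \<Longrightarrow> norm (f r) \<le> m"
  shows "norm i \<le> m * (t - s)"
proof -
  have "0 \<le> m" using order_trans[OF norm_ge_zero le[of s]] \<open>s \<le> t\<close> by simp
  from has_integral_bound_real[OF this finite.emptyI f] le \<open>s \<le> t\<close> show ?thesis by simp
qed

lemma has_integral_orthogonal_le:
  fixes f :: "real \<Rightarrow> 'e::euclidean_space"
  assumes f: "(f has_integral i) {s..t}" and "s \<le> t"
    and le: "\<And>r. r \<in> {s..t} \<Longrightarrow> norm (f r - (f r \<bullet> e) *\<^sub>R e) \<le> m"
  shows "norm (i - (i \<bullet> e) *\<^sub>R e) \<le> m * (t - s)"
proof (rule has_integral_norm_le[OF _ \<open>s \<le> t\<close> le])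
  have "bounded_linear (\<lambda>u. u - (u \<bullet> e) *\<^sub>R e)"
    by (intro bounded_linear_sub bounded_linear_ident bounded_linear_scaleR_left[THEN bounded_linear_compose]
        bounded_linear_inner_left)
  from has_integral_linear[OF f this]
  show "((\<lambda>r. f r - (f r \<bullet> e) *\<^sub>R e) has_integral i - (i \<bullet> e) *\<^sub>R e) {s..t}" by (simp add: o_def)
qed

text \<open>A nonnegative component of the increment along \<open>y\<close> only lengthens
  \<open>y\<close> on its own ray, so the direction turns by the orthogonal component alone.
  Counting the whole increment as perturbation would give an angular speed that is not integrable in
  time.\<close>

lemma norm_sgn_increment_le:
  fixes y \<Delta> :: "'e::real_inner"
  assumes "y \<noteq> 0" "\<Delta> \<bullet> sgn y \<ge> 0" "norm (\<Delta> - (\<Delta> \<bullet> sgn y) *\<^sub>R sgn y) \<le> \<omega>"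
  shows "norm (sgn (y + \<Delta>) - sgn y) \<le> 2 * \<omega> / norm y"
proof -
  define c w where "c = norm y + \<Delta> \<bullet> sgn y" and "w = \<Delta> - (\<Delta> \<bullet> sgn y) *\<^sub>R sgn y"
  have "norm y *\<^sub>R sgn y = y" using assms(1) by (simp add: sgn_div_norm)
  then have eq: "y + \<Delta> = c *\<^sub>R sgn y + w"
    by (simp add: c_def w_def scaleR_add_left)
  have c: "c \<ge> norm y" "norm y > 0" "c > 0"
    using assms by (auto simp: c_def intro: add_pos_nonneg)
  have sg: "sgn (c *\<^sub>R sgn y) = sgn y" "norm (c *\<^sub>R sgn y) = c" "c *\<^sub>R sgn y \<noteq> 0"
    using c assms(1)
    by (auto simp: sgn_scaleR norm_sgn sgn_zero_iff sgn_div_norm[of "sgn y"])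
  have "norm (sgn (y + \<Delta>) - sgn y) \<le> 2 * norm w / c"
    using norm_sgn_add_diff_le[OF sg(3), of w] sg unfolding eq by simp
  also have "\<dots> \<le> 2 * \<omega> / norm y"
    using c assms(3) norm_ge_zero[of w] unfolding w_def[symmetric] by (intro frac_le) linarith+
  finally show ?thesis .
qed

lemma powr_le_two_powr:
  fixes r s :: real
  assumes "1/2 \<le> r" "r \<le> 2"
  shows "r powr s \<le> 2 powr \<bar>s\<bar>"
proof (cases "s \<ge> 0")
  case True
  then show ?thesis using assms by (simp add: powr_mono2)
next
  case False
  have "r powr s = (1 / r) powr (-s)" using assms by (simp add: powr_divide powr_minus field_simps)
  also have "\<dots> \<le> 2 powr (-s)" using assms False by (intro powr_mono2) (auto simp: field_simps)
  finally show ?thesis using False by simp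
qed

lemma convergent_if_norm_diff_le:
  fixes F :: "real \<Rightarrow> 'e::banach"
  assumes le: "\<And>s t. 0 \<le> s \<Longrightarrow> s \<le> t \<Longrightarrow> norm (F t - F s) \<le> g s" and g: "(g \<longlongrightarrow> 0) at_top"
  obtains L where "(F \<longlongrightarrow> L) at_top"
proof -
  have gn: "(\<lambda>n. g (real n)) \<longlonglongrightarrow> 0"
    by (rule filterlim_compose[OF g filterlim_real_sequentially])
  have "Cauchy (\<lambda>n. F (real n))"
    unfolding Cauchy_altdef2
  proof (intro allI impI)
    fix e :: real assume "e > 0"
    with gn have "eventually (\<lambda>n. g (real n) < e) sequentially" by (rule order_tendstoD(2))
    then obtain N where "g (real N) < e" by (auto simp: eventually_sequentially)
    have "dist (F (real n)) (F (real N)) < e" if "n \<ge> N" for n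
      using le[of "real N" "real n"] that \<open>g (real N) < e\<close> by (simp add: dist_norm)
    then show "\<exists>N. \<forall>n\<ge>N. dist (F (real n)) (F (real N)) < e" by blast
  qed
  then obtain L where L: "(\<lambda>n. F (real n)) \<longlonglongrightarrow> L"
    by (metis Cauchy_convergent_iff convergent_def)
  have bound: "norm (L - F s) \<le> g s" if "0 \<le> s" for s
  proof (rule LIMSEQ_le_const2)
    show "(\<lambda>n. norm (F (real n) - F s)) \<longlonglongrightarrow> norm (L - F s)" by (intro tendsto_intros L)
    obtain N :: nat where "s \<le> real N" using real_arch_simple by blast
    then have "norm (F (real n) - F s) \<le> g s" if "n \<ge> N" for n
      using le[OF \<open>0 \<le> s\<close>, of "real n"] that by simp
    then show "\<exists>N. \<forall>n\<ge>N. norm (F (real n) - F s) \<le> g s" by blast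
  qed
  have "((\<lambda>s. F s - L) \<longlongrightarrow> 0) at_top"
    by (rule Lim_null_comparison[OF _ g], rule eventually_mono[OF eventually_ge_at_top[of 0]])
       (metis bound norm_minus_commute)
  then show ?thesis using that LIM_zero_cancel by blast
qed

context radial_drift
begin

lemma inner_sgn_drift: "x \<noteq> 0 \<Longrightarrow> A x \<bullet> sgn x = a x * norm x powr \<beta>"
  using radial[of x] by (simp add: rad_part_def sgn_zero_iff)

text \<open>At x = y + z the radial drift is a multiple of x, and the projection orthogonal to
  \<open>y\<close> kills \<open>y\<close>, so that only |x|^(\<beta> - 1) |z| survives, with a
  factor bounded far out. The tangential drift supplies the other term. The condition on
  \<open>z\<close> keeps |x| within a factor 2 of |y|.\<close>

lemma drift_orthogonal_le:
  obtains C R where "C > 0" "R > 0"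
    "\<And>y z. norm y \<ge> R \<Longrightarrow> norm z \<le> norm y / 2 \<Longrightarrow>
       norm (A (y + z) - (A (y + z) \<bullet> sgn y) *\<^sub>R sgn y)
         \<le> C * (norm y powr (\<beta> - 1) * norm z + norm y powr (\<beta> - \<gamma>))"
proof -
  obtain \<eta> R\<^sub>1 where R1: "\<eta> > 0" "R\<^sub>1 > 0" "\<And>y z. norm y \<ge> R\<^sub>1 \<Longrightarrow> norm z \<le> \<eta> * norm y \<Longrightarrow>
       norm (A (y + z) - (abar (sgn y) * norm y powr \<beta>) *\<^sub>R sgn y) \<le> 1 * norm y powr \<beta>"
    using drift_approx[of 1] by (metis zero_less_one)
  have "bounded (abar ` sphere 0 1)"
    by (intro compact_imp_bounded compact_continuous_image abar_cont compact_sphere)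
  then obtain B where B: "B > 0" "\<And>\<phi>. \<phi> \<in> sphere 0 1 \<Longrightarrow> \<bar>abar \<phi>\<bar> \<le> B"
    unfolding bounded_pos by auto
  \<comment> \<open>\<open>drift_approx\<close> with error 1 and z = 0, projected on the direction
    of \<open>x\<close>, puts a(x) within 1 of \<open>abar\<close>, which is bounded on the
    sphere.\<close>
  have a_le: "\<bar>a x\<bar> \<le> B + 1" if "norm x \<ge> R\<^sub>1" for x
  proof -
    have x: "x \<noteq> 0" using that R1 by auto
    then have s: "sgn x \<bullet> sgn x = 1" by (simp add: norm_sgn dot_square_norm)
    have "\<bar>a x - abar (sgn x)\<bar> * norm x powr \<beta> = \<bar>(A x - (abar (sgn x) * norm x powr \<beta>) *\<^sub>R sgn x) \<bullet> sgn x\<bar>"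
      by (simp add: inner_diff_left s inner_sgn_drift[OF x] abs_mult left_diff_distrib[symmetric])
    also have "\<dots> \<le> norm (A x - (abar (sgn x) * norm x powr \<beta>) *\<^sub>R sgn x) * norm (sgn x)"
      by (rule Cauchy_Schwarz_ineq2)
    also have "\<dots> \<le> norm x powr \<beta>"
      using R1(3)[OF that, of 0] R1(1) x by (simp add: norm_sgn)
    finally have "\<bar>a x - abar (sgn x)\<bar> \<le> 1" using x by (simp add: mult_le_cancel_right1)
    moreover have "\<bar>abar (sgn x)\<bar> \<le> B" using B(2) x by (simp add: norm_sgn)
    ultimately show ?thesis by linarith
  qed
  \<comment> \<open>The factors 2 bound the norm of the projection, crudely; the powers of 2 come
    from replacing |x| by |y|. The radius makes |x| \<ge> |y| / 2 exceed both
    \<open>R\<^sub>1\<close> and \<open>R\<^sub>0\<close>.\<close>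
  define C where "C = 2 * (B + 1) * 2 powr \<bar>\<beta> - 1\<bar> + 2 * \<bar>C\<^sub>0\<bar> * 2 powr \<bar>\<beta> - \<gamma>\<bar>"
  define R where "R = 2 * (R\<^sub>1 + \<bar>R\<^sub>0\<bar> + 1)"
  have "C > 0" unfolding C_def using B by (intro add_pos_nonneg) auto
  moreover have "R > 0" using R1 by (auto simp: R_def)
  moreover have "norm (A (y + z) - (A (y + z) \<bullet> sgn y) *\<^sub>R sgn y)
         \<le> C * (norm y powr (\<beta> - 1) * norm z + norm y powr (\<beta> - \<gamma>))"
    if y: "norm y \<ge> R" and z: "norm z \<le> norm y / 2" for y z
  proof -
    define x e where "x = y + z" and "e = sgn y"
    define pr where "pr u = u - (u \<bullet> e) *\<^sub>R e" for u
    have y0: "norm y > 0" "y \<noteq> 0" using y \<open>R > 0\<close> by auto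
    have e: "norm e = 1" "e \<bullet> e = 1" using y0 by (auto simp: e_def norm_sgn dot_square_norm)
    have pr_le: "norm (pr u) \<le> 2 * norm u" for u
    proof -
      have "norm (pr u) \<le> norm u + \<bar>u \<bullet> e\<bar> * norm e"
        unfolding pr_def using norm_triangle_ineq4[of u "(u \<bullet> e) *\<^sub>R e"] by simp
      also have "\<bar>u \<bullet> e\<bar> \<le> norm u * norm e" by (rule Cauchy_Schwarz_ineq2)
      finally show ?thesis using e by simp
    qed
    have pr_add: "pr (u + v) = pr u + pr v" for u v by (simp add: pr_def algebra_simps)
    have pr_scale: "pr (c *\<^sub>R u) = c *\<^sub>R pr u" for c u by (simp add: pr_def scaleR_diff_right)
    have "pr e = 0" using e by (simp add: pr_def)
    moreover have ye: "y = norm y *\<^sub>R e" using y0 by (simp add: e_def sgn_div_norm)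
    ultimately have "pr y = 0" by (metis pr_scale scaleR_zero_right)
    then have prx: "pr x = pr z" by (simp add: x_def pr_add)
    have xl: "norm x \<ge> norm y / 2" "norm x \<le> 2 * norm y"
      using z norm_triangle_ineq[of y z] norm_diff_ineq[of y z] by (auto simp: x_def)
    then have x0: "norm x > 0" "x \<noteq> 0" and xR: "norm x \<ge> R\<^sub>1" "norm x > R\<^sub>0"
      using y y0 R1 by (auto simp: R_def)
    have ratio: "1/2 \<le> norm x / norm y" "norm x / norm y \<le> 2"
      using xl y0 by (auto simp: field_simps)
    have pw: "norm x powr s \<le> 2 powr \<bar>s\<bar> * norm y powr s" for s
      using powr_le_two_powr[OF ratio, of s] y0 x0 by (simp add: powr_divide field_simps)
    have "A x = (a x * norm x powr (\<beta> - 1)) *\<^sub>R x + tan_part A x"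
      using x0 by (subst drift_decomp) (simp add: sgn_div_norm powr_diff field_simps)
    then have "pr (A x) = (a x * norm x powr (\<beta> - 1)) *\<^sub>R pr z + pr (tan_part A x)"
      by (simp add: pr_add pr_scale prx)
    also have "norm \<dots> \<le> \<bar>a x\<bar> * norm x powr (\<beta> - 1) * norm (pr z) + norm (pr (tan_part A x))"
      by (rule order_trans[OF norm_triangle_ineq]) (simp add: abs_mult)
    also have "\<dots> \<le> (B + 1) * (2 powr \<bar>\<beta> - 1\<bar> * norm y powr (\<beta> - 1)) * (2 * norm z)
        + 2 * (\<bar>C\<^sub>0\<bar> * (2 powr \<bar>\<beta> - \<gamma>\<bar> * norm y powr (\<beta> - \<gamma>)))"
    proof (rule add_mono)
      show "\<bar>a x\<bar> * norm x powr (\<beta> - 1) * norm (pr z)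
        \<le> (B + 1) * (2 powr \<bar>\<beta> - 1\<bar> * norm y powr (\<beta> - 1)) * (2 * norm z)"
        using a_le[OF xR(1)] pw B(1) by (intro mult_mono pr_le) auto
      have "norm (pr (tan_part A x)) \<le> 2 * norm (tan_part A x)" by (rule pr_le)
      also have "norm (tan_part A x) \<le> C\<^sub>0 * norm x powr (\<beta> - \<gamma>)" by (rule tangential[OF xR(2)])
      also have "\<dots> \<le> \<bar>C\<^sub>0\<bar> * (2 powr \<bar>\<beta> - \<gamma>\<bar> * norm y powr (\<beta> - \<gamma>))"
        by (intro mult_mono pw) auto
      finally show "norm (pr (tan_part A x)) \<le> 2 * (\<bar>C\<^sub>0\<bar> * (2 powr \<bar>\<beta> - \<gamma>\<bar> * norm y powr (\<beta> - \<gamma>)))"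
        by simp
    qed
    also have "\<dots> \<le> C * (norm y powr (\<beta> - 1) * norm z + norm y powr (\<beta> - \<gamma>))"
    proof -
      have "C * (norm y powr (\<beta> - 1) * norm z + norm y powr (\<beta> - \<gamma>))
        = (B + 1) * (2 powr \<bar>\<beta> - 1\<bar> * norm y powr (\<beta> - 1)) * (2 * norm z)
          + 2 * (\<bar>C\<^sub>0\<bar> * (2 powr \<bar>\<beta> - \<gamma>\<bar> * norm y powr (\<beta> - \<gamma>)))
          + 2 * \<bar>C\<^sub>0\<bar> * 2 powr \<bar>\<beta> - \<gamma>\<bar> * (norm y powr (\<beta> - 1) * norm z)
          + 2 * (B + 1) * 2 powr \<bar>\<beta> - 1\<bar> * norm y powr (\<beta> - \<gamma>)"
        by (simp add: C_def algebra_simps)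
      moreover have "0 \<le> 2 * \<bar>C\<^sub>0\<bar> * 2 powr \<bar>\<beta> - \<gamma>\<bar> * (norm y powr (\<beta> - 1) * norm z)"
        "0 \<le> 2 * (B + 1) * 2 powr \<bar>\<beta> - 1\<bar> * norm y powr (\<beta> - \<gamma>)"
        using B(1) by auto
      ultimately show ?thesis by linarith
    qed
    finally show ?thesis by (simp add: pr_def x_def e_def)
  qed
  ultimately show ?thesis by (rule that)
qed

end

section \<open>Trajectories of the perturbed equation\<close>

text \<open>Since \<open>A (x r)\<close> is merely integrable in \<open>r\<close>, \<open>y\<close> is differentiable only almost everywhere. It is
  accessed through its increments alone, which replaces the chain rule for absolutely continuous functions.\<close>

locale perturbed_trajectory = radial_drift A a abar \<beta> \<gamma> C\<^sub>0 R\<^sub>0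
  for A :: "'e::euclidean_space \<Rightarrow> 'e" and a abar \<beta> \<gamma> C\<^sub>0 R\<^sub>0 +
  fixes x y :: "real \<Rightarrow> 'e" and k :: "real \<Rightarrow> real"
  assumes increment: "\<And>s t. 0 \<le> s \<Longrightarrow> s \<le> t \<Longrightarrow> ((\<lambda>r. A (x r)) has_integral (y t - y s)) {s..t}"
    and perturbation: "\<And>t. 0 \<le> t \<Longrightarrow> norm (x t - y t) \<le> k t"
    and perturbation_cont: "\<And>t. 0 \<le> t \<Longrightarrow> isCont k t"
begin

lemma y_cont: "0 \<le> s \<Longrightarrow> continuous_on {s..t} y"
proof -
  assume "0 \<le> s"
  have "continuous_on {0..t} (\<lambda>r. y 0 + integral {0..r} (\<lambda>r. A (x r)))" if "0 \<le> t"
    using increment[OF _ that] by (intro continuous_intros indefinite_integral_continuous_1) auto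
  then have "continuous_on {0..t} y"
    by (cases "0 \<le> t") (auto elim!: continuous_on_eq simp: integral_unique[OF increment])
  then show ?thesis using \<open>0 \<le> s\<close> by (auto elim: continuous_on_subset)
qed

lemma y_tendsto_right: "0 \<le> t \<Longrightarrow> (y \<longlongrightarrow> y t) (at_right t)"
  using y_cont[of t "t + 1"] by (rule continuous_on_Icc_at_rightD) auto

text \<open>The path \<open>x\<close> may jump at once, but its distance to \<open>y\<close> is
  dominated by the continuous \<open>k\<close>. The 1 is slack for the motion of \<open>y\<close>
  and \<open>k\<close> during a short time.\<close>

lemma window:
  assumes "0 \<le> t"
  shows "eventually (\<lambda>s. \<forall>r\<in>{t..s}. norm (x r - y t) \<le> k t + 1) (at_right t)"
proof (rule eventually_at_right_Icc)
  show "norm (x t - y t) \<le> k t + 1" using perturbation[OF assms] by simp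
  have "((\<lambda>s. k s + norm (y s - y t)) \<longlongrightarrow> k t + norm (y t - y t)) (at_right t)"
    using perturbation_cont[OF assms] y_tendsto_right[OF assms]
    by (intro tendsto_intros) (auto simp: isCont_def filterlim_at_split)
  then have "eventually (\<lambda>s. k s + norm (y s - y t) < k t + 1) (at_right t)"
    by (rule order_tendstoD(2)) simp
  then show "eventually (\<lambda>s. norm (x s - y t) \<le> k t + 1) (at_right t)"
    using eventually_at_right_less[of t]
  proof eventually_elim
    case (elim s)
    have "norm (x s - y t) \<le> norm (x s - y s) + norm (y s - y t)"
      using norm_triangle_ineq[of "x s - y s" "y s - y t"] by simp
    with elim perturbation[of s] assms show ?case by simp
  qed
qed

text \<open>Throughout the window the drift differs from one fixed multiple of sgn (y t) by at most
  \<epsilon> |y t|^\<beta>, and this is integrated. Projecting on the direction gives the lower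
  bounds, the norm gives the upper one. The bound on the inner product provides the sign that
  \<open>angular_window\<close> asks for.\<close>

lemma radial_window:
  assumes t: "0 \<le> t" and yt: "y t \<noteq> 0" and kt: "k t + 1 \<le> \<eta> * norm (y t)"
    and approx: "\<forall>z. norm z \<le> \<eta> * norm (y t) \<longrightarrow>
       norm (A (y t + z) - (abar (sgn (y t)) * norm (y t) powr \<beta>) *\<^sub>R sgn (y t)) \<le> \<epsilon> * norm (y t) powr \<beta>"
  shows "eventually (\<lambda>s. norm (y t) + (abar (sgn (y t)) - \<epsilon>) * norm (y t) powr \<beta> * (s - t) \<le> norm (y s)
      \<and> norm (y s) \<le> norm (y t) + (abar (sgn (y t)) + \<epsilon>) * norm (y t) powr \<beta> * (s - t)
      \<and> (abar (sgn (y t)) - \<epsilon>) * norm (y t) powr \<beta> * (s - t) \<le> (y s - y t) \<bullet> sgn (y t)) (at_right t)"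
  using window[OF t] eventually_at_right_less[of t]
proof eventually_elim
  case (elim s)
  define e \<alpha> \<nu> where "e = sgn (y t)" and "\<alpha> = abar e" and "\<nu> = norm (y t) powr \<beta>"
  have e: "norm e = 1" "e \<bullet> e = 1" using yt by (auto simp: e_def norm_sgn dot_square_norm)
  have ye: "y t \<bullet> e = norm (y t)"
    using yt by (simp add: e_def sgn_div_norm dot_square_norm power2_eq_square)
  have \<alpha>: "\<alpha> > 0" using abar_pos[of e] e by (simp add: \<alpha>_def)
  have \<nu>: "\<nu> > 0" using yt by (simp add: \<nu>_def)
  have near: "norm (A (x r) - (\<alpha> * \<nu>) *\<^sub>R e) \<le> \<epsilon> * \<nu>" if "r \<in> {t..s}" for r
    using approx[rule_format, of "x r - y t"] elim(1) that kt by (force simp: \<alpha>_def \<nu>_def e_def)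
  have int: "((\<lambda>r. A (x r)) has_integral (y s - y t)) {t..s}" "t \<le> s"
    using increment[OF t] elim(2) by auto
  have "(\<alpha> - \<epsilon>) * \<nu> * (s - t) \<le> (y s - y t) \<bullet> e"
  proof (rule has_integral_inner_ge[OF int])
    fix r assume "r \<in> {t..s}"
    have "\<bar>(A (x r) - (\<alpha> * \<nu>) *\<^sub>R e) \<bullet> e\<bar> \<le> \<epsilon> * \<nu>"
      using Cauchy_Schwarz_ineq2[of "A (x r) - (\<alpha> * \<nu>) *\<^sub>R e" e] near[OF \<open>r \<in> {t..s}\<close>] e by simp
    then show "(\<alpha> - \<epsilon>) * \<nu> \<le> A (x r) \<bullet> e" using e by (simp add: inner_diff_left algebra_simps)
  qed
  moreover have "(y s - y t) \<bullet> e \<le> norm (y s) - norm (y t)"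
    using norm_cauchy_schwarz[of "y s" e] e ye by (simp add: inner_diff_left)
  moreover have "norm (y s - y t) \<le> (\<alpha> + \<epsilon>) * \<nu> * (s - t)"
  proof (rule has_integral_norm_le[OF int])
    fix r assume "r \<in> {t..s}"
    have "norm (A (x r)) \<le> norm (A (x r) - (\<alpha> * \<nu>) *\<^sub>R e) + norm ((\<alpha> * \<nu>) *\<^sub>R e)"
      using norm_triangle_ineq[of "A (x r) - (\<alpha> * \<nu>) *\<^sub>R e" "(\<alpha> * \<nu>) *\<^sub>R e"] by simp
    then show "norm (A (x r)) \<le> (\<alpha> + \<epsilon>) * \<nu>"
      using near[OF \<open>r \<in> {t..s}\<close>] \<alpha> \<nu> e by (simp add: algebra_simps)
  qed
  moreover have "norm (y s) \<le> norm (y t) + norm (y s - y t)"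
    using norm_triangle_ineq[of "y t" "y s - y t"] by simp
  ultimately show ?case unfolding e_def[symmetric] \<alpha>_def[symmetric] \<nu>_def[symmetric] by linarith
qed

lemma angular_window:
  assumes t: "0 \<le> t" and yt: "y t \<noteq> 0"
    and inner: "eventually (\<lambda>s. 0 \<le> (y s - y t) \<bullet> sgn (y t)) (at_right t)"
    and orth: "\<forall>z. norm z \<le> k t + 1 \<longrightarrow> norm (A (y t + z) - (A (y t + z) \<bullet> sgn (y t)) *\<^sub>R sgn (y t)) \<le> \<omega>"
  shows "eventually (\<lambda>s. norm (sgn (y s) - sgn (y t)) \<le> 2 * \<omega> / norm (y t) * (s - t)) (at_right t)"
  using window[OF t] eventually_at_right_less[of t] inner
proof eventually_elim
  case (elim s)
  have int: "((\<lambda>r. A (x r)) has_integral (y s - y t)) {t..s}" "t \<le> s"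
    using increment[OF t] elim(2) by auto
  have "norm ((y s - y t) - ((y s - y t) \<bullet> sgn (y t)) *\<^sub>R sgn (y t)) \<le> \<omega> * (s - t)"
  proof (rule has_integral_orthogonal_le[OF int])
    fix r assume "r \<in> {t..s}"
    then show "norm (A (x r) - (A (x r) \<bullet> sgn (y t)) *\<^sub>R sgn (y t)) \<le> \<omega>"
      using orth[rule_format, of "x r - y t"] elim(1) by simp
  qed
  from norm_sgn_increment_le[OF yt elim(3) this] show ?case by simp
qed

lemma norm_powr_cont: "0 \<le> s \<Longrightarrow> continuous_on {s..t} (\<lambda>t. norm (y t) powr (1 - \<beta>))"
  using beta by (intro continuous_on_powr' continuous_intros y_cont) auto

text \<open>Stands in for separation of variables in r' \<ge> \<mu> r^\<beta>. Local information is
  required only before \<open>b\<close>, never at \<open>b\<close> itself.\<close>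

lemma norm_powr_ge:
  assumes "0 \<le> T" "T \<le> b" "\<kappa> < (1 - \<beta>) * \<mu>"
    and pos: "\<And>t. T \<le> t \<Longrightarrow> t < b \<Longrightarrow> y t \<noteq> 0"
    and inc: "\<And>t. T \<le> t \<Longrightarrow> t < b \<Longrightarrow>
      eventually (\<lambda>s. norm (y t) + \<mu> * norm (y t) powr \<beta> * (s - t) \<le> norm (y s)) (at_right t)"
  shows "norm (y T) powr (1 - \<beta>) + \<kappa> * (b - T) \<le> norm (y b) powr (1 - \<beta>)"
proof -
  define h where "h t = norm (y t) powr (1 - \<beta>) - \<kappa> * t" for t
  have "h T \<le> h b"
  proof (rule right_nondecreasing_imp_le[OF \<open>T \<le> b\<close>])
    show "continuous_on {T..b} h"
      unfolding h_def by (intro continuous_intros norm_powr_cont assms)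
    fix t assume t: "T \<le> t" "t < b"
    have "norm (y t) > 0" using pos[OF t] by simp
    from powr_increment_ge[OF this assms(3), of t] inc[OF t]
    show "eventually (\<lambda>s. h t \<le> h s) (at_right t)"
    proof eventually_elim
      case (elim s)
      then have "norm (y s) powr (1 - \<beta>) \<ge> (norm (y t) + \<mu> * norm (y t) powr \<beta> * (s - t)) powr (1 - \<beta>)"
        using beta by (intro powr_mono2) auto
      with elim show ?case by (simp add: h_def algebra_simps)
    qed
  qed
  then show ?thesis by (simp add: h_def algebra_simps)
qed

lemma norm_powr_le:
  assumes "0 \<le> T" "T \<le> b" "(1 - \<beta>) * \<mu> < \<kappa>"
    and pos: "\<And>t. T \<le> t \<Longrightarrow> t < b \<Longrightarrow> y t \<noteq> 0"
    and inc: "\<And>t. T \<le> t \<Longrightarrow> t < b \<Longrightarrow>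
      eventually (\<lambda>s. norm (y s) \<le> norm (y t) + \<mu> * norm (y t) powr \<beta> * (s - t)) (at_right t)"
  shows "norm (y b) powr (1 - \<beta>) \<le> norm (y T) powr (1 - \<beta>) + \<kappa> * (b - T)"
proof -
  define h where "h t = \<kappa> * t - norm (y t) powr (1 - \<beta>)" for t
  have "h T \<le> h b"
  proof (rule right_nondecreasing_imp_le[OF \<open>T \<le> b\<close>])
    show "continuous_on {T..b} h"
      unfolding h_def by (intro continuous_intros norm_powr_cont assms)
    fix t assume t: "T \<le> t" "t < b"
    have "norm (y t) > 0" using pos[OF t] by simp
    from powr_increment_le[OF this assms(3), of t] inc[OF t]
    show "eventually (\<lambda>s. h t \<le> h s) (at_right t)"
    proof eventually_elim
      case (elim s)
      then have "norm (y s) powr (1 - \<beta>) \<le> (norm (y t) + \<mu> * norm (y t) powr \<beta> * (s - t)) powr (1 - \<beta>)"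
        using beta by (intro powr_mono2) auto
      with elim show ?case by (simp add: h_def algebra_simps)
    qed
  qed
  then show ?thesis by (simp add: h_def algebra_simps)
qed

lemma norm_powr_powr: "(norm (y t) powr (1 - \<beta>)) powr (1 / (1 - \<beta>)) = norm (y t)"
  using beta by (simp add: powr_powr)

text \<open>A bootstrap argument: \<open>step\<close> needs the lower bound on \<open>y\<close>, but yields growth at a rate above \<open>\<kappa>\<close>,
  so \<open>|y|\<close> to the power \<open>1 - \<beta>\<close>, which starts above \<open>2 M\<close>, cannot come down to the line \<open>M + \<kappa> t\<close>.\<close>

lemma escape:
  assumes \<kappa>: "0 < \<kappa>" "\<kappa> < (1 - \<beta>) * \<mu>" and M: "0 < M"
    and init: "norm (y 0) \<ge> (2 * M) powr (1 / (1 - \<beta>))"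
    and step: "\<And>t. 0 \<le> t \<Longrightarrow> (M + \<kappa> * t) powr (1 / (1 - \<beta>)) \<le> norm (y t) \<Longrightarrow>
      eventually (\<lambda>s. norm (y t) + \<mu> * norm (y t) powr \<beta> * (s - t) \<le> norm (y s)) (at_right t)"
    and t: "0 \<le> t"
  shows "(M + \<kappa> * t) powr (1 / (1 - \<beta>)) \<le> norm (y t)"
proof -
  define u where "u t = norm (y t) powr (1 - \<beta>)" for t
  have u0: "u 0 \<ge> 2 * M"
  proof -
    have "2 * M = ((2 * M) powr (1 / (1 - \<beta>))) powr (1 - \<beta>)" using M beta by (simp add: powr_powr)
    also have "\<dots> \<le> u 0" unfolding u_def using init beta by (intro powr_mono2) auto
    finally show ?thesis .
  qed
  have conv: "(M + \<kappa> * s) powr (1 / (1 - \<beta>)) \<le> norm (y s)" if "0 \<le> s" "M + \<kappa> * s \<le> u s" for s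
  proof -
    have "(M + \<kappa> * s) powr (1 / (1 - \<beta>)) \<le> u s powr (1 / (1 - \<beta>))"
      using that M \<kappa> beta by (intro powr_mono2) auto
    then show ?thesis by (simp add: u_def norm_powr_powr)
  qed
  have "M + \<kappa> * t \<le> u t"
  proof (rule ccontr)
    assume neg: "\<not> ?thesis"
    define S where "S = {s\<in>{0..t}. u s \<le> M + \<kappa> * s}"
    have "continuous_on {0..t} u" unfolding u_def by (rule norm_powr_cont) simp
    then have "closed S"
      unfolding S_def by (intro continuous_on_closed_Collect_le continuous_intros) auto
    moreover have "t \<in> S" "bdd_below S"
      using t neg by (auto simp: S_def intro!: bdd_belowI[of _ 0])
    ultimately have "Inf S \<in> S" by (intro closed_contains_Inf) auto
    then have c: "0 \<le> Inf S" "Inf S \<le> t" "u (Inf S) \<le> M + \<kappa> * Inf S" by (auto simp: S_def)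
    have below: "(M + \<kappa> * s) powr (1 / (1 - \<beta>)) \<le> norm (y s)" if "0 \<le> s" "s < Inf S" for s
    proof (rule conv[OF that(1)])
      have "s \<notin> S" using cInf_lower[OF _ \<open>bdd_below S\<close>, of s] that by auto
      then show "M + \<kappa> * s \<le> u s" using that c by (auto simp: S_def)
    qed
    \<comment> \<open>Before Inf S the curve lies above the line, so the conditional hypothesis
      \<open>step\<close> is available on the whole half-open interval; at Inf S itself nothing has
      to be known.\<close>
    have "u 0 + \<kappa> * (Inf S - 0) \<le> u (Inf S)"
      unfolding u_def
    proof (rule norm_powr_ge[OF _ c(1) \<kappa>(2)])
      fix s assume s: "0 \<le> s" "s < Inf S"
      then have "0 < M + \<kappa> * s" using M \<kappa> by (intro add_pos_nonneg) auto
      then have "0 < (M + \<kappa> * s) powr (1 / (1 - \<beta>))" by simp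
      with below[OF s] show "y s \<noteq> 0" by auto
      show "eventually (\<lambda>r. norm (y s) + \<mu> * norm (y s) powr \<beta> * (r - s) \<le> norm (y r)) (at_right s)"
        by (rule step[OF s(1) below[OF s]])
    qed simp
    with u0 c M show False by simp
  qed
  from conv[OF t this] show ?thesis .
qed

end

section \<open>Convergence of the direction and the exact growth rate\<close>

context perturbed_trajectory
begin

text \<open>The bound on the angular speed is integrable in time, so the oscillation of the
  direction after time s is at most a tail integral of order (1 + s)^(-\<rho>).\<close>

lemma direction_limit:
  assumes c: "0 \<le> c" and \<rho>: "0 < \<rho>" and y0: "\<And>t. 0 \<le> t \<Longrightarrow> y t \<noteq> 0"
    and angular: "\<And>t. 0 \<le> t \<Longrightarrow>
      eventually (\<lambda>s. norm (sgn (y s) - sgn (y t)) \<le> c * (1 + t) powr (-1 - \<rho>) * (s - t)) (at_right t)"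
  obtains \<phi> where "\<phi> \<in> sphere 0 1" "((\<lambda>t. sgn (y t)) \<longlongrightarrow> \<phi>) at_top"
proof -
  \<comment> \<open>A primitive of (c + 1) (1 + t)^(-1 - \<rho>). The constant c + 1 in place of c
    makes the derivative strictly larger than the angular speed, so that increments of G dominate
    the linear bound near each time, also for c = 0.\<close>
  define G where "G t = - ((c + 1) / \<rho>) * (1 + t) powr (-\<rho>)" for t :: real
  have dG: "(G has_real_derivative (c + 1) * (1 + t) powr (-1 - \<rho>)) (at t)" if "0 \<le> t" for t
  proof -
    have "((\<lambda>t. (1 + t) powr (-\<rho>)) has_real_derivative (-\<rho>) * (1 + t) powr (-\<rho> - 1)) (at t)"
      using that by (auto intro!: derivative_eq_intros)
    from DERIV_cmult[OF this, of "- ((c + 1) / \<rho>)"] show ?thesis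
      using \<rho> minus_diff_commute[of \<rho> 1] by (simp add: G_def[abs_def] diff_divide_distrib)
  qed
  have osc: "norm (sgn (y t) - sgn (y s)) \<le> ((c + 1) / \<rho>) * (1 + s) powr (-\<rho>)" if st: "0 \<le> s" "s \<le> t" for s t
  proof -
    have "norm (sgn (y t) - sgn (y s)) \<le> G t - G s"
    proof (rule norm_diff_le_right_increments[OF \<open>s \<le> t\<close>])
      show "continuous_on {s..t} (\<lambda>t. sgn (y t))"
        unfolding sgn_div_norm using y0 st by (intro continuous_intros y_cont) auto
      show "continuous_on {s..t} G"
        using dG st by (intro DERIV_atLeastAtMost_imp_continuous_on) (meson order_trans)
      fix r assume r: "s \<le> r" "r < t"
      then have r0: "0 \<le> r" using st by simp
      define \<delta> where "\<delta> = c * (1 + r) powr (-1 - \<rho>)"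
      have "((\<lambda>s. G s - \<delta> * s) has_real_derivative (c + 1) * (1 + r) powr (-1 - \<rho>) - \<delta> * 1) (at r)"
        by (intro DERIV_diff dG r0 DERIV_cmult DERIV_ident)
      moreover have "0 < (c + 1) * (1 + r) powr (-1 - \<rho>) - \<delta> * 1"
        using r0 by (simp add: \<delta>_def algebra_simps)
      ultimately obtain d where d: "d > 0" "\<And>h. h > 0 \<Longrightarrow> h < d \<Longrightarrow> G r - \<delta> * r < G (r + h) - \<delta> * (r + h)"
        using DERIV_pos_inc_right by blast
      have "eventually (\<lambda>s. s < r + d) (at_right r)"
        using d(1) unfolding eventually_at_right_field by (intro exI[of _ "r + d"]) auto
      with angular[OF r0] eventually_at_right_less[of r]
      show "eventually (\<lambda>s. norm (sgn (y s) - sgn (y r)) \<le> G s - G r) (at_right r)"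
      proof eventually_elim
        case (elim s)
        then show ?case using d(2)[of "s - r"] by (simp add: \<delta>_def algebra_simps)
      qed
    qed
    moreover have "G t \<le> 0" using c \<rho> by (simp add: G_def)
    ultimately show ?thesis by (simp add: G_def)
  qed
  have lim: "((\<lambda>s. ((c + 1) / \<rho>) * (1 + s) powr (-\<rho>)) \<longlongrightarrow> 0) at_top"
    using \<rho> by real_asymp
  obtain \<phi> where \<phi>: "((\<lambda>t. sgn (y t)) \<longlongrightarrow> \<phi>) at_top"
    by (rule convergent_if_norm_diff_le[of "\<lambda>t. sgn (y t)", OF osc lim])
  have "((\<lambda>t. norm (sgn (y t))) \<longlongrightarrow> 1) at_top"
    by (rule tendsto_eventually, rule eventually_mono[OF eventually_ge_at_top[of 0]])
      (use y0 in \<open>auto simp: norm_sgn\<close>)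
  with tendsto_norm[OF \<phi>] have "norm \<phi> = 1"
    using tendsto_unique trivial_limit_at_top_linorder by blast
  with \<phi> that show ?thesis by simp
qed

text \<open>Once the direction is close to its limit, \<open>abar\<close> is nearly constant along
  the trajectory. This confines |y|^(1 - \<beta>) between two lines with slopes close to (1 -
  \<beta>) \<open>abar \<phi>\<close>, and division by t removes their initial values.\<close>

lemma growth_rate:
  assumes y0: "\<And>t. 0 \<le> t \<Longrightarrow> y t \<noteq> 0"
    and y_large: "filterlim (\<lambda>t. norm (y t)) at_top at_top"
    and k_small: "((\<lambda>t. (k t + 1) / norm (y t)) \<longlongrightarrow> 0) at_top"
    and \<phi>: "\<phi> \<in> sphere 0 1" "((\<lambda>t. sgn (y t)) \<longlongrightarrow> \<phi>) at_top"
  shows "((\<lambda>t. norm (y t) powr (1 - \<beta>) / t) \<longlongrightarrow> (1 - \<beta>) * abar \<phi>) at_top"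
proof -
  define u l where "u t = norm (y t) powr (1 - \<beta>)" and "l = (1 - \<beta>) * abar \<phi>" for t
  have abar_lim: "((\<lambda>t. abar (sgn (y t))) \<longlongrightarrow> abar \<phi>) at_top"
    by (rule continuous_on_tendsto_compose[OF abar_cont \<phi>(2,1)],
        rule eventually_mono[OF eventually_ge_at_top[of 0]])
      (use y0 in \<open>auto simp: norm_sgn\<close>)
  have close: "eventually (\<lambda>t. \<bar>u t / t - l\<bar> < e) at_top" if "e > 0" for e
  proof -
    \<comment> \<open>The slope is off by 2 \<epsilon>: one \<epsilon> from
      \<open>drift_approx\<close>, one from freezing \<open>abar\<close>. Multiplied by 1 - \<beta>
      this is e / 3, strictly below the e / 2 allowed for the slopes of the two lines.\<close>
    define \<epsilon> where "\<epsilon> = e / 6 / (1 - \<beta>)"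
    have "1 - \<beta> \<noteq> 0" using beta by simp
    then have "(1 - \<beta>) * \<epsilon> = e / 6"
      unfolding \<epsilon>_def
      by (metis nonzero_mult_div_cancel_left times_divide_eq_right)
    moreover have "(1 - \<beta>) * (2 * \<epsilon>) = 2 * ((1 - \<beta>) * \<epsilon>)" by simp
    ultimately have \<epsilon>2: "(1 - \<beta>) * (2 * \<epsilon>) < e / 2" using that by linarith
    have \<epsilon>: "\<epsilon> > 0" using that beta by (simp add: \<epsilon>_def)
    obtain \<eta> R where R: "\<eta> > 0" "R > 0" "\<And>y z. norm y \<ge> R \<Longrightarrow> norm z \<le> \<eta> * norm y \<Longrightarrow>
       norm (A (y + z) - (abar (sgn y) * norm y powr \<beta>) *\<^sub>R sgn y) \<le> \<epsilon> * norm y powr \<beta>"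
      using drift_approx[OF \<epsilon>] by metis
    have "eventually (\<lambda>t. 0 \<le> t \<and> R \<le> norm (y t) \<and> (k t + 1) / norm (y t) < \<eta> \<and> \<bar>abar (sgn (y t)) - abar \<phi>\<bar> < \<epsilon>) at_top"
      using eventually_ge_at_top[of 0] filterlim_at_top[THEN iffD1, OF y_large, rule_format, of R]
        order_tendstoD(2)[OF k_small R(1)] tendstoD[OF abar_lim \<epsilon>]
      by eventually_elim (auto simp: dist_real_def)
    then obtain T where T: "\<And>t. T \<le> t \<Longrightarrow>
        0 \<le> t \<and> R \<le> norm (y t) \<and> (k t + 1) / norm (y t) < \<eta> \<and> \<bar>abar (sgn (y t)) - abar \<phi>\<bar> < \<epsilon>"
      unfolding eventually_at_top_linorder by blast
    have T0: "0 \<le> T" using T[of T] by simp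
    have win: "eventually (\<lambda>s. norm (y t) + (abar \<phi> - 2 * \<epsilon>) * norm (y t) powr \<beta> * (s - t) \<le> norm (y s)
       \<and> norm (y s) \<le> norm (y t) + (abar \<phi> + 2 * \<epsilon>) * norm (y t) powr \<beta> * (s - t)) (at_right t)"
      if t: "T \<le> t" for t
    proof -
      have t0: "0 \<le> t" and yt: "y t \<noteq> 0" and kt: "k t + 1 \<le> \<eta> * norm (y t)"
        using T[OF t] y0 by (auto simp: field_simps)
      have Rt: "R \<le> norm (y t)" using T[OF t] by simp
      have "\<forall>z. norm z \<le> \<eta> * norm (y t) \<longrightarrow>
          norm (A (y t + z) - (abar (sgn (y t)) * norm (y t) powr \<beta>) *\<^sub>R sgn (y t)) \<le> \<epsilon> * norm (y t) powr \<beta>"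
        using R(3)[OF Rt] by blast
      from radial_window[OF t0 yt kt this] eventually_at_right_less[of t]
      show ?thesis
      proof eventually_elim
        case (elim s)
        have "(abar \<phi> - 2 * \<epsilon>) * norm (y t) powr \<beta> * (s - t) \<le> (abar (sgn (y t)) - \<epsilon>) * norm (y t) powr \<beta> * (s - t)"
          "(abar (sgn (y t)) + \<epsilon>) * norm (y t) powr \<beta> * (s - t) \<le> (abar \<phi> + 2 * \<epsilon>) * norm (y t) powr \<beta> * (s - t)"
          using elim T[OF t] by (auto intro!: mult_right_mono)
        then show ?case using elim by linarith
      qed
    qed
    have ynz: "y t \<noteq> 0" if "T \<le> t" for t using y0 T0 that by simp
    have lower: "u T + (l - e / 2) * (t - T) \<le> u t" if "T \<le> t" for t
      unfolding u_def
    proof (rule norm_powr_ge[OF T0 that])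
      show "l - e / 2 < (1 - \<beta>) * (abar \<phi> - 2 * \<epsilon>)"
        using \<epsilon>2 unfolding l_def right_diff_distrib distrib_left by linarith
    qed (use ynz win[unfolded eventually_conj_iff] in blast)+
    have upper: "u t \<le> u T + (l + e / 2) * (t - T)" if "T \<le> t" for t
      unfolding u_def
    proof (rule norm_powr_le[OF T0 that])
      show "(1 - \<beta>) * (abar \<phi> + 2 * \<epsilon>) < l + e / 2"
        using \<epsilon>2 unfolding l_def right_diff_distrib distrib_left by linarith
    qed (use ynz win[unfolded eventually_conj_iff] in blast)+
    \<comment> \<open>An upper bound for all terms of the two linear estimates that do not grow with
      t.\<close>
    define D where "D = u T + (\<bar>l\<bar> + e) * T"
    have "((\<lambda>t. D / t) \<longlongrightarrow> 0) at_top" by real_asymp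
    then have "eventually (\<lambda>t. D / t < e / 2) at_top"
      using \<open>e > 0\<close> by (intro order_tendstoD(2)) auto
    then show ?thesis
      using eventually_ge_at_top[of T] eventually_gt_at_top[of 0]
    proof eventually_elim
      case (elim t)
      have uT: "0 \<le> u T" by (simp add: u_def)
      have eqs: "(l - e / 2) * (t - T) = l * t - l * T - e / 2 * t + e * T / 2"
        "(l + e / 2) * (t - T) = l * t - l * T + e / 2 * t - e * T / 2"
        "D = u T + \<bar>l\<bar> * T + e * T"
        by (simp_all add: D_def field_simps)
      have lT: "l * T \<le> \<bar>l\<bar> * T" "- (l * T) \<le> \<bar>l\<bar> * T" "0 \<le> e * T"
        using T0 \<open>e > 0\<close> mult_right_mono[of l "\<bar>l\<bar>" T] mult_right_mono[of "- l" "\<bar>l\<bar>" T] by simp_all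
      have "u t - l * t \<le> D + e / 2 * t"
        using upper[OF elim(2)] lT uT unfolding eqs by linarith
      moreover have "- (u t - l * t) \<le> D + e / 2 * t"
        using lower[OF elim(2)] lT uT unfolding eqs by linarith
      ultimately have "\<bar>u t - l * t\<bar> \<le> D + e / 2 * t" by (rule abs_leI)
      moreover have "D < e / 2 * t" using elim by (simp add: field_simps)
      ultimately have "\<bar>u t - l * t\<bar> < e * t" by linarith
      moreover have "\<bar>u t / t - l\<bar> = \<bar>u t - l * t\<bar> / t"
        using elim by (simp add: field_simps)
      ultimately show ?case using elim by (simp add: field_simps)
    qed
  qed
  then show ?thesis
    unfolding tendsto_iff dist_real_def u_def l_def by blast
qed

end

section \<open>The limit of a trajectory that starts far away\<close>

context radial_drift
begin

text \<open>The radius is fixed before the trajectory is given and depends only on the drift,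
  \<open>K\<close> and \<open>q\<close>; hence the same radius works for every sample path whose
  noise obeys the bound.\<close>

lemma trajectory_limit:
  assumes K: "0 \<le> K" and q: "0 \<le> q" "q < 1 / (1 - \<beta>)"
  obtains R where "R > 0"
    "\<And>x y. norm (y 0) \<ge> R \<Longrightarrow> \<forall>t\<ge>0. norm (x t - y t) \<le> K * (1 + t) powr q \<Longrightarrow>
      \<forall>s\<ge>0. \<forall>t\<ge>s. ((\<lambda>r. A (x r)) has_integral (y t - y s)) {s..t} \<Longrightarrow>
      \<exists>\<phi>\<in>sphere 0 1. ((\<lambda>t. x t /\<^sub>R t powr (1 / (1 - \<beta>)))
         \<longlongrightarrow> ((1 - \<beta>) * abar \<phi>) powr (1 / (1 - \<beta>)) *\<^sub>R \<phi>) at_top"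
proof -
  define p where "p = 1 / (1 - \<beta>)"
  have p: "p > 0" "p * (1 - \<beta>) = 1" "p * (\<beta> - 1) = -1" and qp: "q < p"
    using beta q by (auto simp: p_def field_simps)
  have "sphere (0::'e) 1 \<noteq> {}" by simp
  from continuous_attains_inf[OF compact_sphere this abar_cont]
  obtain \<phi>\<^sub>0 where "\<phi>\<^sub>0 \<in> sphere 0 1" "\<And>\<phi>. \<phi> \<in> sphere 0 1 \<Longrightarrow> abar \<phi>\<^sub>0 \<le> abar \<phi>" by blast
  then obtain a0 where a0: "a0 > 0" "\<And>\<phi>. \<phi> \<in> sphere 0 1 \<Longrightarrow> a0 \<le> abar \<phi>"
    using abar_pos by metis
  obtain \<eta> R\<^sub>1 where R1: "\<eta> > 0" "R\<^sub>1 > 0" "\<eta> \<le> 1/2" "\<And>y z. norm y \<ge> R\<^sub>1 \<Longrightarrow> norm z \<le> \<eta> * norm y \<Longrightarrow>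
       norm (A (y + z) - (abar (sgn y) * norm y powr \<beta>) *\<^sub>R sgn y) \<le> a0 / 2 * norm y powr \<beta>"
    using drift_approx[of "a0 / 2"] a0(1) by (metis half_gt_zero)
  obtain C R\<^sub>2 where R2: "C > 0" "R\<^sub>2 > 0" "\<And>y z. norm y \<ge> R\<^sub>2 \<Longrightarrow> norm z \<le> norm y / 2 \<Longrightarrow>
       norm (A (y + z) - (A (y + z) \<bullet> sgn y) *\<^sub>R sgn y)
         \<le> C * (norm y powr (\<beta> - 1) * norm z + norm y powr (\<beta> - \<gamma>))"
    using drift_orthogonal_le by metis
  \<comment> \<open>\<mu> is the minimum \<open>a0\<close> of \<open>abar\<close> less the
    approximation error a0 / 2, a lower bound for the radial speed coefficient. \<kappa> is half of
    (1 - \<beta>) \<mu>, which leaves the strict gap that \<open>escape\<close> needs.\<close>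
  define \<mu> \<kappa> where "\<mu> = a0 / 2" and "\<kappa> = (1 - \<beta>) * a0 / 4"
  have \<kappa>: "0 < \<kappa>" "\<kappa> < (1 - \<beta>) * \<mu>" using a0 beta by (auto simp: \<kappa>_def \<mu>_def)
  have lim: "filterlim (\<lambda>M::real. M powr r) at_top at_top" if "r > 0" for r using that by real_asymp
  \<comment> \<open>The first condition gives \<kappa> (1 + t) \<le> M + \<kappa> t, the second puts
    \<open>y\<close> in the range of both drift estimates. The third makes the noise bound plus 1 at
    most \<eta> (M + \<kappa> t)^p; it can be met because q < p.\<close>
  have "eventually (\<lambda>M. \<kappa> \<le> M \<and> max R\<^sub>1 R\<^sub>2 \<le> M powr p \<and> (K + 1) / (\<eta> * \<kappa> powr q) \<le> M powr (p - q)) at_top"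
    using lim[of p] lim[of "p - q"] p qp
    by (intro eventually_conj eventually_ge_at_top) (auto simp: filterlim_at_top simp del: max.bounded_iff)
  then obtain M where M: "\<kappa> \<le> M" "max R\<^sub>1 R\<^sub>2 \<le> M powr p" "(K + 1) / (\<eta> * \<kappa> powr q) \<le> M powr (p - q)"
    by (auto simp: eventually_at_top_linorder)
  have M0: "M > 0" using M \<kappa> by simp
  show ?thesis
  proof (rule that[of "(2 * M) powr p"])
    show "0 < (2 * M) powr p" using M0 by simp
  next
    fix x y :: "real \<Rightarrow> 'e"
    assume init: "norm (y 0) \<ge> (2 * M) powr p"
      and pert: "\<forall>t\<ge>0. norm (x t - y t) \<le> K * (1 + t) powr q"
      and incr: "\<forall>s\<ge>0. \<forall>t\<ge>s. ((\<lambda>r. A (x r)) has_integral (y t - y s)) {s..t}"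
    define k where "k t = K * (1 + t) powr q" for t :: real
    interpret perturbed_trajectory A a abar \<beta> \<gamma> C\<^sub>0 R\<^sub>0 x y k
    proof unfold_locales
      fix t :: real assume "0 \<le> t"
      then show "isCont k t" unfolding k_def by (intro continuous_intros) auto
    qed (use pert incr in \<open>auto simp: k_def\<close>)
    \<comment> \<open>Here q \<ge> 0 matters: (1 + t)^q is at least 1 and absorbs the slack of
      \<open>window\<close>.\<close>
    have k1: "k t + 1 \<le> (K + 1) * (1 + t) powr q" if "0 \<le> t" for t
      using that q ge_one_powr_ge_zero[of "1 + t" q] by (simp add: k_def algebra_simps)
    have far: "norm (y t) \<ge> R\<^sub>1 \<and> norm (y t) \<ge> R\<^sub>2 \<and> k t + 1 \<le> \<eta> * norm (y t)"
      if t: "0 \<le> t" and yt: "(M + \<kappa> * t) powr p \<le> norm (y t)" for t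
    proof -
      have "M powr p \<le> (M + \<kappa> * t) powr p" using M0 \<kappa> t p by (intro powr_mono2) auto
      then have "norm (y t) \<ge> R\<^sub>1" "norm (y t) \<ge> R\<^sub>2" using M yt by auto
      moreover have "k t + 1 \<le> \<eta> * norm (y t)"
      proof -
        have w: "\<kappa> * (1 + t) \<le> M + \<kappa> * t" "M \<le> M + \<kappa> * t" using M \<kappa> t by (auto simp: algebra_simps)
        have "(K + 1) * (1 + t) powr q \<le> (\<eta> * \<kappa> powr q * M powr (p - q)) * (1 + t) powr q"
          using M(3) R1 \<kappa> by (intro mult_right_mono) (auto simp: field_simps)
        also have "\<dots> = \<eta> * (M powr (p - q) * (\<kappa> * (1 + t)) powr q)"
          using \<kappa> t by (simp add: powr_mult)
        also have "\<dots> \<le> \<eta> * ((M + \<kappa> * t) powr (p - q) * (M + \<kappa> * t) powr q)"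
          using w R1 M0 \<kappa> t qp q by (intro mult_left_mono mult_mono powr_mono2) auto
        also have "\<dots> = \<eta> * (M + \<kappa> * t) powr p" by (simp add: powr_add[symmetric])
        also have "\<dots> \<le> \<eta> * norm (y t)" using yt R1 by (intro mult_left_mono) auto
        finally show ?thesis using k1[OF t] by simp
      qed
      ultimately show ?thesis by simp
    qed
    have win: "eventually (\<lambda>s. norm (y t) + \<mu> * norm (y t) powr \<beta> * (s - t) \<le> norm (y s)
        \<and> 0 \<le> (y s - y t) \<bullet> sgn (y t)) (at_right t)"
      if t: "0 \<le> t" and yt: "(M + \<kappa> * t) powr p \<le> norm (y t)" for t
    proof -
      note f = far[OF t yt]
      have y0: "y t \<noteq> 0" using f R1(2) by auto
      have al: "\<mu> \<le> abar (sgn (y t)) - a0 / 2" using a0(2)[of "sgn (y t)"] y0 by (simp add: \<mu>_def norm_sgn)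
      have kt: "k t + 1 \<le> \<eta> * norm (y t)" and Rt: "R\<^sub>1 \<le> norm (y t)" using f by simp_all
      have "\<forall>z. norm z \<le> \<eta> * norm (y t) \<longrightarrow>
          norm (A (y t + z) - (abar (sgn (y t)) * norm (y t) powr \<beta>) *\<^sub>R sgn (y t)) \<le> a0 / 2 * norm (y t) powr \<beta>"
        using R1(4)[OF Rt] by blast
      from radial_window[OF t y0 kt this] eventually_at_right_less[of t]
      show ?thesis
      proof eventually_elim
        case (elim s)
        have "\<mu> * norm (y t) powr \<beta> * (s - t) \<le> (abar (sgn (y t)) - a0 / 2) * norm (y t) powr \<beta> * (s - t)"
          by (intro mult_right_mono al) (use elim in auto)
        moreover have "0 \<le> \<mu> * norm (y t) powr \<beta> * (s - t)"
          using elim a0(1) by (simp add: \<mu>_def)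
        ultimately show ?case using elim by linarith
      qed
    qed
    have large: "(M + \<kappa> * t) powr p \<le> norm (y t)" if "0 \<le> t" for t
      unfolding p_def
    proof (rule escape[OF \<kappa> M0 _ _ that])
      show "(2 * M) powr (1 / (1 - \<beta>)) \<le> norm (y 0)" using init by (simp add: p_def)
      fix t assume "0 \<le> t" "(M + \<kappa> * t) powr (1 / (1 - \<beta>)) \<le> norm (y t)"
      then show "eventually (\<lambda>s. norm (y t) + \<mu> * norm (y t) powr \<beta> * (s - t) \<le> norm (y s)) (at_right t)"
        using win[of t] by (auto simp: p_def elim!: eventually_mono)
    qed
    \<comment> \<open>Weaker than \<open>large\<close>, but a pure power of 1 + t like the noise
      bound, so that rates can be compared through their exponents.\<close>
    have yw: "(\<kappa> * (1 + t)) powr p \<le> norm (y t)" if t: "0 \<le> t" for t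
    proof -
      have "(\<kappa> * (1 + t)) powr p \<le> (M + \<kappa> * t) powr p"
        using t \<kappa> p M by (intro powr_mono2) (auto simp: algebra_simps)
      with large[OF t] show ?thesis by simp
    qed
    have y0: "y t \<noteq> 0" if "0 \<le> t" for t
      using far[OF that large[OF that]] R1(2) by auto
    \<comment> \<open>Since p (\<beta> - 1) = -1, the lower bound on |y| bounds the share of the
      noise in the angular speed by order (1 + t)^(-1 - (p - q)) and that of the tangential drift by
      order (1 + t)^(-1 - p \<gamma>). The slower of the two decays sets \<rho>.\<close>
    define \<rho> where "\<rho> = min (p - q) (p * \<gamma>)"
    have \<rho>: "\<rho> > 0" using qp p gamma by (auto simp: \<rho>_def)
    define c where "c = 2 * C * ((K + 1) * \<kappa> powr (-1 - p) + \<kappa> powr (-1 - p * \<gamma>))"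
    have c: "0 \<le> c" using R2 K by (simp add: c_def)
    have ang: "eventually (\<lambda>s. norm (sgn (y s) - sgn (y t)) \<le> c * (1 + t) powr (-1 - \<rho>) * (s - t)) (at_right t)"
      if t: "0 \<le> t" for t
    proof -
      note f = far[OF t large[OF t]]
      define w where "w = \<kappa> * (1 + t)"
      have w: "w > 0" "w powr p \<le> norm (y t)" using \<kappa> t yw[OF t] by (auto simp: w_def)
      have yp: "norm (y t) > 0" using y0[OF t] by simp
      define \<omega> where "\<omega> = C * (norm (y t) powr (\<beta> - 1) * (k t + 1) + norm (y t) powr (\<beta> - \<gamma>))"
      have orth: "norm (A (y t + z) - (A (y t + z) \<bullet> sgn (y t)) *\<^sub>R sgn (y t)) \<le> \<omega>" if z: "norm z \<le> k t + 1" for z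
      proof -
        have "norm z \<le> norm (y t) / 2"
          using z f R1(3) mult_right_mono[OF R1(3), of "norm (y t)"] by simp
        then have "norm (A (y t + z) - (A (y t + z) \<bullet> sgn (y t)) *\<^sub>R sgn (y t))
           \<le> C * (norm (y t) powr (\<beta> - 1) * norm z + norm (y t) powr (\<beta> - \<gamma>))"
          using R2(3) f by blast
        also have "\<dots> \<le> \<omega>"
          unfolding \<omega>_def using z R2(1) by (intro mult_left_mono add_right_mono) auto
        finally show ?thesis .
      qed
      have "2 * \<omega> / norm (y t) \<le> c * (1 + t) powr (-1 - \<rho>)"
      proof -
        have "p * (\<beta> - 2) = p * (\<beta> - 1) - p" "p * (\<beta> - 1 - \<gamma>) = p * (\<beta> - 1) - p * \<gamma>"
          by (simp_all add: algebra_simps)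
        then have e1: "p * (\<beta> - 2) = -1 - p" and e2: "p * (\<beta> - 1 - \<gamma>) = -1 - p * \<gamma>"
          by (simp_all only: p(3))
        have "2 * \<omega> / norm (y t) = 2 * C * (norm (y t) powr (\<beta> - 2) * (k t + 1) + norm (y t) powr (\<beta> - 1 - \<gamma>))"
          using yp by (simp add: \<omega>_def powr_diff powr_add field_simps powr_numeral power2_eq_square)
        also have "\<dots> \<le> 2 * C * ((w powr p) powr (\<beta> - 2) * ((K + 1) * (1 + t) powr q) + (w powr p) powr (\<beta> - 1 - \<gamma>))"
          using w beta gamma R2(1) k1[OF t] K t
          by (intro mult_left_mono add_mono mult_mono powr_mono2') (auto simp: k_def)
        also have "(w powr p) powr (\<beta> - 2) = w powr (-1 - p)"
          by (simp add: powr_powr e1)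
        also have "(w powr p) powr (\<beta> - 1 - \<gamma>) = w powr (-1 - p * \<gamma>)"
          by (simp add: powr_powr e2)
        also have "2 * C * (w powr (-1 - p) * ((K + 1) * (1 + t) powr q) + w powr (-1 - p * \<gamma>))
          = 2 * C * ((K + 1) * \<kappa> powr (-1 - p) * (1 + t) powr (-1 - (p - q)) + \<kappa> powr (-1 - p * \<gamma>) * (1 + t) powr (-1 - p * \<gamma>))"
        proof -
          have "(1 + t) powr (-1 - (p - q)) = (1 + t) powr (-1 - p) * (1 + t) powr q"
            by (simp add: powr_add[symmetric] algebra_simps)
          moreover have "w powr s = \<kappa> powr s * (1 + t) powr s" for s
            using \<kappa> t by (simp add: w_def powr_mult)
          ultimately show ?thesis by (simp only: mult_ac)
        qed
        also have "\<dots> \<le> 2 * C * ((K + 1) * \<kappa> powr (-1 - p) * (1 + t) powr (-1 - \<rho>) + \<kappa> powr (-1 - p * \<gamma>) * (1 + t) powr (-1 - \<rho>))"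
          using R2(1) K t by (intro mult_left_mono add_mono powr_mono) (auto simp: \<rho>_def)
        also have "\<dots> = c * (1 + t) powr (-1 - \<rho>)" by (simp add: c_def algebra_simps)
        finally show ?thesis .
      qed
      then have mono: "2 * \<omega> / norm (y t) * (s - t) \<le> c * (1 + t) powr (-1 - \<rho>) * (s - t)" if "t < s" for s
        using that by (intro mult_right_mono) auto
      have "eventually (\<lambda>s. 0 \<le> (y s - y t) \<bullet> sgn (y t)) (at_right t)"
        using win[OF t large[OF t]] by (auto elim!: eventually_mono)
      moreover have "\<forall>z. norm z \<le> k t + 1 \<longrightarrow>
          norm (A (y t + z) - (A (y t + z) \<bullet> sgn (y t)) *\<^sub>R sgn (y t)) \<le> \<omega>"
        using orth by blast
      ultimately have "eventually (\<lambda>s. norm (sgn (y s) - sgn (y t)) \<le> 2 * \<omega> / norm (y t) * (s - t)) (at_right t)"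
        by (rule angular_window[OF t y0[OF t]])
      from this eventually_at_right_less[of t]
      show ?thesis by eventually_elim (rule order_trans[OF _ mono])
    qed
    obtain \<phi> where \<phi>: "\<phi> \<in> sphere 0 1" "((\<lambda>t. sgn (y t)) \<longlongrightarrow> \<phi>) at_top"
      using direction_limit[OF c \<rho> y0 ang] by blast
    have y_large: "filterlim (\<lambda>t. norm (y t)) at_top at_top"
    proof (rule filterlim_at_top_mono)
      show "filterlim (\<lambda>t. (\<kappa> * (1 + t)) powr p) at_top at_top" using \<kappa> p by real_asymp
      show "eventually (\<lambda>t. (\<kappa> * (1 + t)) powr p \<le> norm (y t)) at_top"
        using yw by (intro eventually_mono[OF eventually_ge_at_top[of 0]])
    qed
    have k_small: "((\<lambda>t. (k t + 1) / norm (y t)) \<longlongrightarrow> 0) at_top"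
    proof (rule tendsto_sandwich[OF _ _ tendsto_const])
      show "eventually (\<lambda>t. (k t + 1) / norm (y t) \<le> ((K + 1) * (1 + t) powr q) / (\<kappa> * (1 + t)) powr p) at_top"
        using eventually_ge_at_top[of 0]
      proof eventually_elim
        case (elim t)
        then show ?case using k1[OF elim] yw[OF elim] \<kappa> K by (intro frac_le) auto
      qed
      show "((\<lambda>t. ((K + 1) * (1 + t) powr q) / (\<kappa> * (1 + t)) powr p) \<longlongrightarrow> 0) at_top"
        using \<kappa> qp q p K by real_asymp
      show "eventually (\<lambda>t. 0 \<le> (k t + 1) / norm (y t)) at_top"
        using K by (intro always_eventually) (auto simp: k_def)
    qed
    define l where "l = (1 - \<beta>) * abar \<phi>"
    have l: "l > 0" using abar_pos[OF \<phi>(1)] beta by (simp add: l_def)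
    have "((\<lambda>t. norm (y t) powr (1 - \<beta>) / t) \<longlongrightarrow> l) at_top"
      unfolding l_def by (rule growth_rate[OF y0 y_large k_small \<phi>])
    then have "((\<lambda>t. (norm (y t) powr (1 - \<beta>) / t) powr p) \<longlongrightarrow> l powr p) at_top"
      using l by (intro tendsto_powr tendsto_const) auto
    then have "((\<lambda>t. norm (y t) / t powr p) \<longlongrightarrow> l powr p) at_top"
    proof (rule Lim_transform_eventually)
      show "eventually (\<lambda>t. (norm (y t) powr (1 - \<beta>) / t) powr p = norm (y t) / t powr p) at_top"
        using eventually_gt_at_top[of 0]
        by eventually_elim (simp add: powr_divide norm_powr_powr[folded p_def])
    qed
    from tendsto_scaleR[OF this \<phi>(2)]
    have ylim: "((\<lambda>t. (norm (y t) / t powr p) *\<^sub>R sgn (y t)) \<longlongrightarrow> l powr p *\<^sub>R \<phi>) at_top" .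
    have xlim: "((\<lambda>t. (x t - y t) /\<^sub>R t powr p) \<longlongrightarrow> 0) at_top"
    proof (rule Lim_null_comparison)
      show "((\<lambda>t. K * (1 + t) powr q / t powr p) \<longlongrightarrow> 0) at_top" using qp q p K by real_asymp
      show "eventually (\<lambda>t. norm ((x t - y t) /\<^sub>R t powr p) \<le> K * (1 + t) powr q / t powr p) at_top"
        using eventually_gt_at_top[of 0]
      proof eventually_elim
        case (elim t)
        have "norm ((x t - y t) /\<^sub>R t powr p) = norm (x t - y t) / t powr p"
          by (simp add: divide_inverse mult.commute)
        then show ?case using pert elim by (simp add: divide_right_mono)
      qed
    qed
    have "((\<lambda>t. x t /\<^sub>R t powr p) \<longlongrightarrow> l powr p *\<^sub>R \<phi>) at_top"
    proof (rule Lim_transform_eventually)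
      show "((\<lambda>t. (norm (y t) / t powr p) *\<^sub>R sgn (y t) + (x t - y t) /\<^sub>R t powr p) \<longlongrightarrow> l powr p *\<^sub>R \<phi>) at_top"
        using tendsto_add[OF ylim xlim] by simp
      show "eventually (\<lambda>t. (norm (y t) / t powr p) *\<^sub>R sgn (y t) + (x t - y t) /\<^sub>R t powr p = x t /\<^sub>R t powr p) at_top"
        using eventually_ge_at_top[of 0]
        by eventually_elim (use y0 in \<open>auto simp: sgn_div_norm scaleR_diff_right divide_inverse\<close>)
    qed
    then show "\<exists>\<phi>\<in>sphere 0 1. ((\<lambda>t. x t /\<^sub>R t powr (1 / (1 - \<beta>)))
         \<longlongrightarrow> ((1 - \<beta>) * abar \<phi>) powr (1 / (1 - \<beta>)) *\<^sub>R \<phi>) at_top"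
      using \<phi>(1) by (auto simp: p_def l_def)
  qed
qed

end

section \<open>Limits along rational times\<close>

lemma right_continuous_rat_closed:
  fixes f :: "real \<Rightarrow> 'e::metric_space"
  assumes "closed S" and lim: "(f \<longlongrightarrow> f t) (at_right t)" and rat: "\<And>r::rat. t < of_rat r \<Longrightarrow> f (of_rat r) \<in> S"
  shows "f t \<in> S"
proof -
  have "\<exists>r::rat. t < of_rat r \<and> of_rat r < t + inverse (real (Suc n))" for n
    using of_rat_dense[of t "t + inverse (real (Suc n))"] by simp
  then obtain r :: "nat \<Rightarrow> rat" where r: "\<And>n. t < of_rat (r n)" "\<And>n. of_rat (r n) < t + inverse (real (Suc n))"
    by metis
  have "(\<lambda>n. of_rat (r n) :: real) \<longlonglongrightarrow> t"
  proof (rule tendsto_sandwich[of "\<lambda>_. t"])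
    show "(\<lambda>n. t + inverse (real (Suc n))) \<longlonglongrightarrow> t"
      using LIMSEQ_inverse_real_of_nat_add[of t] by simp
  qed (use r in \<open>auto intro!: always_eventually less_imp_le\<close>)
  then have "filterlim (\<lambda>n. of_rat (r n) :: real) (at_right t) sequentially"
    by (rule tendsto_imp_filterlim_at_right) (simp add: r)
  then have flim: "(\<lambda>n. f (of_rat (r n))) \<longlonglongrightarrow> f t"
    by (rule filterlim_compose[OF lim])
  show ?thesis
    by (rule closed_sequentially[OF \<open>closed S\<close> _ flim]) (rule rat[OF r(1)])
qed

text \<open>Only countably many times enter, so that for the product sigma-algebra this is an event;
  on right-continuous paths it is convergence of \<open>w t / t\<^sup>p\<close> to a point of \<open>S\<close>.\<close>

definition scaled_limit_in :: "real \<Rightarrow> 'e::euclidean_space set \<Rightarrow> (real \<Rightarrow> 'e) \<Rightarrow> bool" where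
  "scaled_limit_in p S w \<longleftrightarrow> (\<forall>n::nat. \<exists>m::nat. \<forall>(r::rat) (s::rat). of_nat m \<le> r \<and> of_nat m \<le> s \<longrightarrow>
     dist (w (of_rat r) /\<^sub>R of_rat r powr p) (w (of_rat s) /\<^sub>R of_rat s powr p) \<le> inverse (Suc n) \<and>
     infdist (w (of_rat r) /\<^sub>R of_rat r powr p) S \<le> inverse (Suc n))"

lemma path_space_component [measurable]: "0 \<le> t \<Longrightarrow> (\<lambda>w. w t) \<in> borel_measurable path_space"
  unfolding path_space_def by (rule measurable_component_singleton) simp

lemma scaled_limit_in_sets:
  "{w\<in>space path_space. scaled_limit_in p S w} \<in> sets path_space"
proof -
  have "{w\<in>space path_space. of_nat m \<le> r \<and> of_nat m \<le> s \<longrightarrow>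
     dist (w (of_rat r) /\<^sub>R of_rat r powr p) (w (of_rat s) /\<^sub>R of_rat s powr p) \<le> inverse (Suc n) \<and>
     infdist (w (of_rat r) /\<^sub>R of_rat r powr p) S \<le> inverse (Suc n)} \<in> sets path_space"
    for n m :: nat and r s :: rat
  proof (cases "of_nat m \<le> r \<and> of_nat m \<le> s")
    case True
    then have "0 \<le> r" "0 \<le> s" using order_trans[OF of_nat_0_le_iff[of m]] by blast+
    then have [measurable]: "(\<lambda>w. w (of_rat r)) \<in> borel_measurable path_space"
      "(\<lambda>w. w (of_rat s)) \<in> borel_measurable path_space" by auto
    have [measurable]: "(\<lambda>x. infdist x S) \<in> borel_measurable borel"
      by (intro borel_measurable_continuous_onI continuous_intros)
    show ?thesis using True by simp
  next
    case False
    then have "(of_nat m \<le> r \<and> of_nat m \<le> s) = False" by blast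
    then show ?thesis by (simp only: simp_thms Collect_mem_eq sets.top)
  qed
  then show ?thesis
    unfolding scaled_limit_in_def
    by (intro sets.sets_Collect_countable_All sets.sets_Collect_countable_Ex)
qed

lemma scaled_limit_in_restrict [simp]: "scaled_limit_in p S (\<lambda>t\<in>{0..}. w t) = scaled_limit_in p S w"
proof -
  have "restrict w {0..} (of_rat r) = w (of_rat r)" if "of_nat m \<le> r" for r :: rat and m :: nat
    using order_trans[OF of_nat_0_le_iff that] by simp
  then show ?thesis unfolding scaled_limit_in_def by (metis (no_types, lifting))
qed

lemma scaled_limit_in_if_tendsto:
  assumes "L \<in> S" "((\<lambda>t. w t /\<^sub>R t powr p) \<longlongrightarrow> L) at_top"
  shows "scaled_limit_in p S w"
  unfolding scaled_limit_in_def
proof (intro allI)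
  fix n :: nat
  have "eventually (\<lambda>t. dist (w t /\<^sub>R t powr p) L < inverse (Suc n) / 2) at_top"
    using assms(2) by (rule tendstoD) simp
  then obtain b where b: "\<And>t. b \<le> t \<Longrightarrow> dist (w t /\<^sub>R t powr p) L < inverse (Suc n) / 2"
    by (auto simp: eventually_at_top_linorder)
  obtain m :: nat where "b \<le> real m" using real_arch_simple by blast
  then have near: "dist (w (of_rat r) /\<^sub>R of_rat r powr p) L < inverse (Suc n) / 2" if "of_nat m \<le> r" for r :: rat
    using that by (intro b) (metis of_rat_less_eq of_rat_of_nat_eq order_trans)
  show "\<exists>m::nat. \<forall>(r::rat) (s::rat). of_nat m \<le> r \<and> of_nat m \<le> s \<longrightarrow>
     dist (w (of_rat r) /\<^sub>R of_rat r powr p) (w (of_rat s) /\<^sub>R of_rat s powr p) \<le> inverse (Suc n) \<and>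
     infdist (w (of_rat r) /\<^sub>R of_rat r powr p) S \<le> inverse (Suc n)"
  proof (intro exI allI impI conjI)
    fix r s :: rat assume rs: "of_nat m \<le> r \<and> of_nat m \<le> s"
    show "dist (w (of_rat r) /\<^sub>R of_rat r powr p) (w (of_rat s) /\<^sub>R of_rat s powr p) \<le> inverse (Suc n)"
      using near[of r] near[of s] rs
        dist_triangle2[of "w (of_rat r) /\<^sub>R of_rat r powr p" "w (of_rat s) /\<^sub>R of_rat s powr p" L]
      by linarith
    have "dist (w (of_rat r) /\<^sub>R of_rat r powr p) L \<le> inverse (Suc n)"
      using near[of r] rs zero_le_dist[of "w (of_rat r) /\<^sub>R of_rat r powr p" L] by linarith
    then show "infdist (w (of_rat r) /\<^sub>R of_rat r powr p) S \<le> inverse (Suc n)"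
      by (rule infdist_le2[OF \<open>L \<in> S\<close>])
  qed
qed

text \<open>The values at integers form a Cauchy sequence, whose limit is in the closed set
  \<open>S\<close> because its distance to \<open>S\<close> is 0. Late rational times stay near this
  limit, and right-continuity extends the closed bound to real times.\<close>

lemma scaled_limit_in_tendsto:
  assumes lim: "scaled_limit_in p S w" and "closed S" "S \<noteq> {}"
    and right: "\<And>t. 0 \<le> t \<Longrightarrow> (w \<longlongrightarrow> w t) (at_right t)"
  obtains L where "L \<in> S" "((\<lambda>t. w t /\<^sub>R t powr p) \<longlongrightarrow> L) at_top"
proof -
  define V where "V t = w t /\<^sub>R t powr p" for t
  have V: "\<exists>m::nat. \<forall>(r::rat) (s::rat). of_nat m \<le> r \<and> of_nat m \<le> s \<longrightarrow>
     dist (V (of_rat r)) (V (of_rat s)) \<le> inverse (Suc n) \<and> infdist (V (of_rat r)) S \<le> inverse (Suc n)" for n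
    using lim unfolding scaled_limit_in_def V_def by blast
  have Vright: "(V \<longlongrightarrow> V t) (at_right t)" if "0 < t" for t
  proof -
    have "((\<lambda>s::real. s) \<longlongrightarrow> t) (at_right t)" by (rule tendsto_ident_at)
    then show ?thesis
      unfolding V_def using that right[of t] by (intro tendsto_intros tendsto_inverse) auto
  qed
  have "Cauchy (\<lambda>n. V (real n))"
  proof (rule metric_CauchyI)
    fix e :: real assume "0 < e"
    then obtain n where n: "inverse (real (Suc n)) < e" using reals_Archimedean by blast
    obtain m :: nat where m: "\<And>r s::rat. of_nat m \<le> r \<Longrightarrow> of_nat m \<le> s \<Longrightarrow> dist (V (of_rat r)) (V (of_rat s)) \<le> inverse (Suc n)"
      using V[of n] by blast
    have "dist (V (real i)) (V (real j)) < e" if "m \<le> i" "m \<le> j" for i j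
      using m[of "of_nat i" "of_nat j"] that n by (simp add: of_rat_of_nat_eq)
    then show "\<exists>M. \<forall>i\<ge>M. \<forall>j\<ge>M. dist (V (real i)) (V (real j)) < e" by blast
  qed
  then obtain L where L: "(\<lambda>n. V (real n)) \<longlonglongrightarrow> L"
    by (metis Cauchy_convergent_iff convergent_def)
  have "infdist L S \<le> inverse (Suc n)" for n
  proof (rule LIMSEQ_le_const2)
    show "(\<lambda>i. infdist (V (real i)) S) \<longlonglongrightarrow> infdist L S" by (intro tendsto_intros L)
    obtain m :: nat where m: "\<And>r::rat. of_nat m \<le> r \<Longrightarrow> infdist (V (of_rat r)) S \<le> inverse (Suc n)"
      using V[of n] by blast
    show "\<exists>N. \<forall>i\<ge>N. infdist (V (real i)) S \<le> inverse (Suc n)"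
      by (metis m of_nat_le_iff of_rat_of_nat_eq)
  qed
  then have "infdist L S \<le> 0"
    using LIMSEQ_le_const[OF LIMSEQ_inverse_real_of_nat, of "infdist L S"] by blast
  then have "L \<in> S"
    using assms infdist_nonneg[of L S] by (simp add: in_closed_iff_infdist_zero)
  moreover have "(V \<longlongrightarrow> L) at_top"
    unfolding tendsto_iff
  proof (intro allI impI)
    fix e :: real assume "0 < e"
    then obtain n where n: "inverse (real (Suc n)) < e" using reals_Archimedean by blast
    obtain m :: nat where m: "\<And>r s::rat. of_nat m \<le> r \<Longrightarrow> of_nat m \<le> s \<Longrightarrow> dist (V (of_rat r)) (V (of_rat s)) \<le> inverse (Suc n)"
      using V[of n] by blast
    have rat: "V (of_rat r) \<in> cball L (inverse (Suc n))" if "of_nat m \<le> r" for r :: rat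
    proof -
      have "dist L (V (of_rat r)) \<le> inverse (Suc n)"
      proof (rule LIMSEQ_le_const2)
        show "(\<lambda>i. dist (V (real i)) (V (of_rat r))) \<longlonglongrightarrow> dist L (V (of_rat r))" by (intro tendsto_intros L)
        show "\<exists>N. \<forall>i\<ge>N. dist (V (real i)) (V (of_rat r)) \<le> inverse (Suc n)"
          by (metis m that of_nat_le_iff of_rat_of_nat_eq)
      qed
      then show ?thesis by simp
    qed
    \<comment> \<open>The additional 1 keeps t positive; division by t^p need not be continuous at
      0.\<close>
    have "V t \<in> cball L (inverse (Suc n))" if "real m + 1 \<le> t" for t
    proof (rule right_continuous_rat_closed[OF closed_cball Vright])
      fix r :: rat assume "t < of_rat r"
      then have "(of_rat (of_nat m) :: real) \<le> of_rat r" using that by (simp add: of_rat_of_nat_eq)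
      then show "V (of_rat r) \<in> cball L (inverse (Suc n))" by (intro rat) (simp only: of_rat_less_eq)
    qed (use that in linarith)
    then have "dist (V t) L < e" if "real m + 1 \<le> t" for t
      using that n by (force simp: dist_commute)
    then show "eventually (\<lambda>t. dist (V t) L < e) at_top"
      unfolding eventually_at_top_linorder by blast
  qed
  ultimately show ?thesis by (rule that[unfolded V_def[symmetric]])
qed

lemma tendsto_scaled_shift:
  fixes w :: "real \<Rightarrow> 'e::real_normed_vector"
  assumes "((\<lambda>t. w (s + t) /\<^sub>R t powr p) \<longlongrightarrow> L) at_top"
  shows "((\<lambda>t. w t /\<^sub>R t powr p) \<longlongrightarrow> L) at_top"
proof -
  have "filterlim (\<lambda>t. t - s) at_top at_top" by real_asymp
  from filterlim_compose[OF assms this]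
  have *: "((\<lambda>t. w t /\<^sub>R (t - s) powr p) \<longlongrightarrow> L) at_top" by simp
  have "((\<lambda>t. (t - s) / t) \<longlongrightarrow> 1) at_top" by real_asymp
  then have "((\<lambda>t. ((t - s) / t) powr p) \<longlongrightarrow> 1 powr p) at_top" by (intro tendsto_intros) auto
  from tendsto_scaleR[OF this *]
  have "((\<lambda>t. ((t - s) / t) powr p *\<^sub>R (w t /\<^sub>R (t - s) powr p)) \<longlongrightarrow> L) at_top" by simp
  then show ?thesis
  proof (rule Lim_transform_eventually)
    show "eventually (\<lambda>t. ((t - s) / t) powr p *\<^sub>R (w t /\<^sub>R (t - s) powr p) = w t /\<^sub>R t powr p) at_top"
      using eventually_gt_at_top[of 0] eventually_gt_at_top[of s]
      by eventually_elim (simp add: powr_divide field_simps)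
  qed
qed

text \<open>The two one-sided limits bound the path near each point, and bisection makes this
  global. Intersecting with \<open>{0..}\<close> is necessary at the left end because nothing is
  known about the path at negative times.\<close>

lemma cadlag_bounded_Icc:
  fixes f :: "real \<Rightarrow> 'e::real_normed_vector"
  assumes "cadlag f"
  shows "bounded (f ` {0..b})"
proof -
  have "bounded (f ` ({0..max 0 b} \<inter> {0..}))" (is "?P 0 (max 0 b)")
  proof (rule Bolzano[where P = "\<lambda>a b. bounded (f ` ({a..b} \<inter> {0..}))"])
    fix a b c :: real
    assume "bounded (f ` ({a..b} \<inter> {0..}))" "bounded (f ` ({b..c} \<inter> {0..}))" "a \<le> b" "b \<le> c"
    moreover have "f ` ({a..c} \<inter> {0..}) \<subseteq> f ` ({a..b} \<inter> {0..}) \<union> f ` ({b..c} \<inter> {0..})"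
      unfolding image_Un[symmetric] by (intro image_mono) auto
    ultimately show "bounded (f ` ({a..c} \<inter> {0..}))" using bounded_subset bounded_Un by metis
  next
    fix x :: real assume x: "0 \<le> x"
    have lim_bound: "eventually (\<lambda>t. norm (f t) < norm l + 1) F" if "(f \<longlongrightarrow> l) F" for l F
      using order_tendstoD(2)[OF tendsto_norm[OF that], of "norm l + 1"] by simp
    obtain d1 where d1: "d1 > x" "\<And>t. x < t \<Longrightarrow> t < d1 \<Longrightarrow> norm (f t) < norm (f x) + 1"
      using lim_bound[of "f x" "at_right x"] assms x
      unfolding cadlag_def eventually_at_right_field by blast
    obtain d2 B where d2: "d2 < x" "\<And>t. 0 \<le> t \<Longrightarrow> d2 < t \<Longrightarrow> t < x \<Longrightarrow> norm (f t) < B"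
    proof (cases "x = 0")
      case True
      then show ?thesis using that[of "-1" 0] by auto
    next
      case False
      with assms x obtain l where "(f \<longlongrightarrow> l) (at_left x)" unfolding cadlag_def by force
      from lim_bound[OF this] show ?thesis
        unfolding eventually_at_left_field using that by blast
    qed
    show "\<exists>d>0. \<forall>a b. a \<le> x \<and> x \<le> b \<and> b - a < d \<longrightarrow> bounded (f ` ({a..b} \<inter> {0..}))"
    proof (intro exI conjI allI impI)
      show "0 < min (d1 - x) (x - d2)" using d1(1) d2(1) by simp
      fix a b assume ab: "a \<le> x \<and> x \<le> b \<and> b - a < min (d1 - x) (x - d2)"
      show "bounded (f ` ({a..b} \<inter> {0..}))"
        unfolding bounded_iff
      proof (intro exI ballI)
        fix v assume "v \<in> f ` ({a..b} \<inter> {0..})"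
        then obtain t where t: "v = f t" "a \<le> t" "t \<le> b" "0 \<le> t" by auto
        consider "t < x" | "t = x" | "x < t" by linarith
        then show "norm v \<le> max B (norm (f x) + 1)"
        proof cases
          case 1
          then show ?thesis using d2(2)[of t] t ab by force
        next
          case 3
          then show ?thesis using d1(2)[of t] t ab by force
        qed (simp add: t)
      qed
    qed
  qed simp
  then show ?thesis by (rule bounded_subset) auto
qed

section \<open>First entrance into the exterior of a ball\<close>

text \<open>Rational times suffice: for a right-continuous path an exceedance at a real time
  persists for a while and is seen at rational times just after it. The infimum is then countable,
  hence measurable.\<close>

definition exit_time :: "(real \<Rightarrow> 'w \<Rightarrow> 'e::real_normed_vector) \<Rightarrow> real \<Rightarrow> 'w \<Rightarrow> ereal" where
  "exit_time X R \<omega> = (INF q\<in>{0::rat..}. if R < norm (X (of_rat q) \<omega>) then ereal (of_rat q) else \<infinity>)"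

lemma exit_time_less_iff:
  "exit_time X R \<omega> < ereal t \<longleftrightarrow> (\<exists>q\<ge>0::rat. of_rat q < t \<and> R < norm (X (of_rat q) \<omega>))"
  unfolding exit_time_def INF_less_iff by (auto split: if_splits)

lemma exit_time_nonneg: "0 \<le> exit_time X R \<omega>"
  unfolding exit_time_def by (rule INF_greatest) (auto simp: zero_le_of_rat_iff)

lemma exit_time_finite_iff: "exit_time X R \<omega> < \<infinity> \<longleftrightarrow> (\<exists>q\<ge>0::rat. R < norm (X (of_rat q) \<omega>))"
  unfolding exit_time_def INF_less_iff by (auto split: if_splits)

lemma measurable_exit_time:
  assumes "\<And>t. 0 \<le> t \<Longrightarrow> X t \<in> borel_measurable M"
  shows "exit_time X R \<in> borel_measurable M"
proof -
  have [measurable]: "X (of_rat q) \<in> borel_measurable M" if "q \<in> {0..}" for q :: rat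
    using that by (intro assms) (simp add: zero_le_of_rat_iff)
  show ?thesis
    unfolding exit_time_def[abs_def] by measurable
qed

text \<open>The event is the intersection of the events that the exit time lies before t + 1/n, and
  these look slightly beyond \<open>t\<close>. This is why the filtration is made
  right-continuous.\<close>

lemma exit_time_le_natural_event:
  fixes X :: "real \<Rightarrow> 'w \<Rightarrow> 'e::real_normed_vector"
  assumes "0 \<le> t"
  shows "{\<omega>\<in>space M. exit_time X R \<omega> \<le> ereal t} \<in> natural_events M X t"
  unfolding natural_events_def
proof (rule INT_I)
  fix s assume "s \<in> {t<..}"
  then obtain N :: nat where N: "inverse (real (Suc N)) < s - t"
    using reals_Archimedean[of "s - t"] by auto
  define G where "G = {X r -` A \<inter> space M | r A. 0 \<le> r \<and> r \<le> s \<and> A \<in> sets borel}"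
  interpret sigma_algebra "space M" "sigma_sets (space M) G"
    by (rule sigma_algebra_sigma_sets) (auto simp: G_def)
  \<comment> \<open>The offset N keeps all these times below s.\<close>
  define h where "h n = t + inverse (real (Suc (N + n)))" for n
  have hs: "h n < s" for n
  proof -
    have "inverse (real (Suc (N + n))) \<le> inverse (real (Suc N))"
      by (intro le_imp_inverse_le) auto
    then show ?thesis unfolding h_def using N by linarith
  qed
  have h: "h \<longlonglongrightarrow> t"
    using LIMSEQ_ignore_initial_segment[OF LIMSEQ_inverse_real_of_nat_add[of t], of N]
    by (simp add: h_def[abs_def] add.commute)
  have "exit_time X R \<omega> \<le> ereal t \<longleftrightarrow> (\<forall>n. exit_time X R \<omega> < ereal (h n))" for \<omega>
  proof
    assume le: "exit_time X R \<omega> \<le> ereal t"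
    have "t < h n" for n by (simp add: h_def)
    with le show "\<forall>n. exit_time X R \<omega> < ereal (h n)" by (auto intro: le_less_trans)
  next
    assume "\<forall>n. exit_time X R \<omega> < ereal (h n)"
    then show "exit_time X R \<omega> \<le> ereal t"
      using h by (intro LIMSEQ_le_const[of "\<lambda>n. ereal (h n)"]) (auto intro: less_imp_le)
  qed
  then have "{\<omega>\<in>space M. exit_time X R \<omega> \<le> ereal t}
      = {\<omega>\<in>space M. \<forall>n. \<exists>q::rat. (0 \<le> q \<and> of_rat q < h n) \<and> R < norm (X (of_rat q) \<omega>)}"
    by (auto simp: exit_time_less_iff)
  also have "\<dots> \<in> sigma_sets (space M) G"
  proof (intro sets_Collect_countable_All sets_Collect_countable_Ex)
    fix n and q :: rat
    show "{\<omega>\<in>space M. (0 \<le> q \<and> of_rat q < h n) \<and> R < norm (X (of_rat q) \<omega>)} \<in> sigma_sets (space M) G"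
    proof (cases "0 \<le> q \<and> of_rat q < h n")
      case True
      have "{x::'e. R < norm x} \<in> sets borel" by measurable
      moreover have "(0::real) \<le> of_rat q" "of_rat q \<le> s"
        using True less_trans[OF _ hs[of n]] by (auto simp: zero_le_of_rat_iff intro: less_imp_le)
      ultimately have "X (of_rat q) -` {x. R < norm x} \<inter> space M \<in> G"
        unfolding G_def by blast
      moreover have "{\<omega>\<in>space M. (0 \<le> q \<and> of_rat q < h n) \<and> R < norm (X (of_rat q) \<omega>)}
          = X (of_rat q) -` {x. R < norm x} \<inter> space M"
        using True by auto
      ultimately show ?thesis by auto
    next
      case False
      then have "{\<omega>\<in>space M. (0 \<le> q \<and> of_rat q < h n) \<and> R < norm (X (of_rat q) \<omega>)} = {}" by blast
      then show ?thesis by (simp only: empty_sets)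
    qed
  qed
  finally show "{\<omega>\<in>space M. exit_time X R \<omega> \<le> ereal t} \<in> sigma_sets (space M)
      {X r -` A \<inter> space M | r A. 0 \<le> r \<and> r \<le> s \<and> A \<in> sets borel}"
    unfolding G_def .
qed

text \<open>A value of norm below R would persist to the right and rule out exceedances just after
  the exit time. A jump may overshoot, which is harmless: only a lower bound on the norm is
  used.\<close>

lemma norm_at_exit_time:
  fixes X :: "real \<Rightarrow> 'w \<Rightarrow> 'e::real_normed_vector"
  assumes fin: "exit_time X R \<omega> < \<infinity>" and right: "\<And>t. 0 \<le> t \<Longrightarrow> ((\<lambda>s. X s \<omega>) \<longlongrightarrow> X t \<omega>) (at_right t)"
  shows "R \<le> norm (X (real_of_ereal (exit_time X R \<omega>)) \<omega>)"
proof (rule ccontr)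
  define T where "T = real_of_ereal (exit_time X R \<omega>)"
  have T: "exit_time X R \<omega> = ereal T" "0 \<le> T"
    using fin exit_time_nonneg[of X R \<omega>] by (auto simp: T_def ereal_real real_of_ereal_pos)
  assume "\<not> ?thesis"
  then have lt: "norm (X T \<omega>) < R" by (simp add: T_def)
  then have "eventually (\<lambda>s. norm (X s \<omega>) < R) (at_right T)"
    using right[OF T(2)] by (intro order_tendstoD(2)) (auto intro: tendsto_norm)
  then obtain b where b: "b > T" "\<And>s. T < s \<Longrightarrow> s < b \<Longrightarrow> norm (X s \<omega>) < R"
    unfolding eventually_at_right_field by blast
  from b(1) T have "exit_time X R \<omega> < ereal b" by simp
  then obtain q :: rat where q: "q \<ge> 0" "of_rat q < b" "R < norm (X (of_rat q) \<omega>)"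
    unfolding exit_time_less_iff by blast
  have "exit_time X R \<omega> \<le> ereal (of_rat q)"
    unfolding exit_time_def by (rule INF_lower2[of q]) (use q in auto)
  then have "T \<le> of_rat q" using T by simp
  with q b lt show False by (metis less_le less_asym)
qed

text \<open>Approximation from the right by random times with values in a countable grid;
  right-continuity of the paths passes to the limit.\<close>

lemma measurable_at_random_time:
  fixes X :: "real \<Rightarrow> 'w \<Rightarrow> 'e::metric_space"
  assumes X: "\<And>t. 0 \<le> t \<Longrightarrow> X t \<in> borel_measurable M"
    and right: "\<And>\<omega> t. \<omega> \<in> space M \<Longrightarrow> 0 \<le> t \<Longrightarrow> ((\<lambda>s. X s \<omega>) \<longlongrightarrow> X t \<omega>) (at_right t)"
    and T [measurable]: "T \<in> borel_measurable M" and T0: "\<And>\<omega>. 0 \<le> T \<omega>"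
  shows "(\<lambda>\<omega>. X (T \<omega>) \<omega>) \<in> borel_measurable M"
proof -
  \<comment> \<open>Floor plus one, so that the grid point lies strictly to the right of s, as
    convergence within \<open>at_right\<close> demands.\<close>
  define d where "d n s = (of_int \<lfloor>s * real (Suc n)\<rfloor> + 1) / real (Suc n)" for n and s :: real
  have d: "s < d n s" "d n s \<le> s + inverse (real (Suc n))" for n s
  proof -
    have "s * real (Suc n) < of_int \<lfloor>s * real (Suc n)\<rfloor> + 1" "of_int \<lfloor>s * real (Suc n)\<rfloor> \<le> s * real (Suc n)"
      by linarith+
    then show "s < d n s" "d n s \<le> s + inverse (real (Suc n))"
      unfolding d_def by (simp_all add: pos_less_divide_eq pos_divide_le_eq field_simps del: of_nat_Suc)
  qed
  have dlim: "filterlim (\<lambda>n. d n s) (at_right s) sequentially" for s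
  proof -
    have "(\<lambda>n. d n s) \<longlonglongrightarrow> s"
    proof (rule tendsto_sandwich[of "\<lambda>_. s"])
      show "(\<lambda>n. s + inverse (real (Suc n))) \<longlonglongrightarrow> s" by (rule LIMSEQ_inverse_real_of_nat_add)
      show "eventually (\<lambda>n. s \<le> d n s) sequentially"
        using d(1) by (intro always_eventually allI less_imp_le)
      show "eventually (\<lambda>n. d n s \<le> s + inverse (real (Suc n))) sequentially"
        using d(2) by (intro always_eventually allI)
    qed simp
    then show ?thesis by (rule tendsto_imp_filterlim_at_right) (simp add: d)
  qed
  show ?thesis
  proof (rule borel_measurable_LIMSEQ_metric)
    fix n
    have "(\<lambda>\<omega>. (\<lambda>i \<omega>. X (max 0 ((of_int i + 1) / real (Suc n))) \<omega>) \<lfloor>T \<omega> * real (Suc n)\<rfloor> \<omega>) \<in> borel_measurable M"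
      by (rule measurable_compose_countable) (auto intro!: X)
    moreover have "max 0 ((of_int \<lfloor>T \<omega> * real (Suc n)\<rfloor> + 1) / real (Suc n)) = d n (T \<omega>)" for \<omega>
      using d(1)[of "T \<omega>" n] T0[of \<omega>] unfolding d_def by linarith
    ultimately show "(\<lambda>\<omega>. X (d n (T \<omega>)) \<omega>) \<in> borel_measurable M" by simp
  next
    fix \<omega> assume "\<omega> \<in> space M"
    show "(\<lambda>n. X (d n (T \<omega>)) \<omega>) \<longlonglongrightarrow> X (T \<omega>) \<omega>"
      by (rule filterlim_compose[OF right[OF \<open>\<omega> \<in> space M\<close> T0] dlim])
  qed
qed

section \<open>Transfer of probabilities by the strong Markov property\<close>

lemma weak_solutionD:
  assumes "weak_solution E S"
  shows "prob_space (prb S)" "\<And>t. 0 \<le> t \<Longrightarrow> proc S t \<in> borel_measurable (prb S)"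
    "\<And>\<omega>. \<omega> \<in> space (prb S) \<Longrightarrow> cadlag (\<lambda>t. proc S t \<omega>)"
    "\<And>\<omega> t. \<omega> \<in> space (prb S) \<Longrightarrow> 0 \<le> t \<Longrightarrow> ((\<lambda>s. proc S s \<omega>) \<longlongrightarrow> proc S t \<omega>) (at_right t)"
proof -
  have sub: "\<And>t. 0 \<le> t \<Longrightarrow> subalgebra (prb S) (filt S t)"
    and adp: "\<And>t. 0 \<le> t \<Longrightarrow> proc S t \<in> borel_measurable (filt S t)"
    using assms unfolding weak_solution_def usual_basis_def adapted_def by blast+
  show "\<And>t. 0 \<le> t \<Longrightarrow> proc S t \<in> borel_measurable (prb S)"
    using measurable_from_subalg[OF sub adp] .
  show "prob_space (prb S)" and cad: "\<And>\<omega>. \<omega> \<in> space (prb S) \<Longrightarrow> cadlag (\<lambda>t. proc S t \<omega>)"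
    using assms unfolding weak_solution_def usual_basis_def by blast+
  show "\<And>\<omega> t. \<omega> \<in> space (prb S) \<Longrightarrow> 0 \<le> t \<Longrightarrow> ((\<lambda>s. proc S s \<omega>) \<longlongrightarrow> proc S t \<omega>) (at_right t)"
    using cad unfolding cadlag_def by blast
qed

lemma measurable_path:
  assumes "\<And>t. 0 \<le> t \<Longrightarrow> X t \<in> borel_measurable M"
  shows "(\<lambda>\<omega>. \<lambda>t\<in>{0..}. X t \<omega>) \<in> M \<rightarrow>\<^sub>M path_space"
  unfolding path_space_def by (rule measurable_restrict) (use assms in auto)

lemma measure_path_law:
  assumes "weak_solution E S" "B \<in> sets path_space"
  shows "measure (path_law S) B = measure (prb S) {\<omega>\<in>space (prb S). (\<lambda>t\<in>{0..}. proc S t \<omega>) \<in> B}"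
  unfolding path_law_def
  by (subst measure_distr[OF measurable_path[OF weak_solutionD(2)[OF assms(1)]] assms(2)])
    (auto intro!: arg_cong[where f = "measure _"])

text \<open>The Markov property at the stopping time 0. It carries an almost sure statement from
  deterministic starting points to a solution with a random initial value.\<close>

lemma strong_markov_at_start:
  assumes sol: "weak_solution E S" and sm: "strong_markov P S" and B: "B \<in> sets path_space"
    and one: "\<And>x. measure (P x) B = 1"
  shows "AE \<omega> in prb S. (\<lambda>t\<in>{0..}. proc S t \<omega>) \<in> B"
proof -
  interpret prob_space "prb S" by (rule weak_solutionD(1)[OF sol])
  have ev: "space (prb S) \<in> natural_events (prb S) (proc S) t" for t
    unfolding natural_events_def by (auto intro!: sigma_sets_top)
  have "\<forall>D\<in>sets (prb S). (\<forall>t\<ge>0. D \<inter> {\<omega>\<in>space (prb S). (0::ereal) \<le> ereal t} \<in> natural_events (prb S) (proc S) t)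
      \<and> (\<forall>\<omega>\<in>D. (0::ereal) < \<infinity>) \<longrightarrow> (\<forall>B\<in>sets path_space.
         measure (prb S) {\<omega>\<in>D. (\<lambda>t\<in>{0..}. proc S (real_of_ereal 0 + t) \<omega>) \<in> B}
           = (LINT \<omega>:D|prb S. measure (P (proc S (real_of_ereal 0) \<omega>)) B))"
    using sm ev unfolding strong_markov_def Let_def
    by (elim conjE allE[of _ "\<lambda>_. 0"]) auto
  from this[rule_format, OF sets.top _ B] ev
  have "measure (prb S) {\<omega>\<in>space (prb S). (\<lambda>t\<in>{0..}. proc S t \<omega>) \<in> B} = (LINT \<omega>:space (prb S)|prb S. 1)"
    by (simp add: one zero_ereal_def[symmetric])
  also have "\<dots> = 1"
    unfolding set_lebesgue_integral_def by (subst Bochner_Integration.integral_cong[of _ _ _ "\<lambda>_. 1"]) (auto simp: prob_space)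
  finally show ?thesis
    using AE_prob_1 by fastforce
qed

text \<open>At the exit time the position has norm at least R, so the conditional probability that
  the shifted path lies in B is at least c; integrating this over the almost sure event of a finite
  exit time gives the bound. The hypothesis \<open>shift\<close> brings the shifted path back to the
  original one.\<close>

lemma strong_markov_at_exit:
  assumes sol: "weak_solution E S" and sm: "strong_markov P S" and B: "B \<in> sets path_space"
    and exit: "AE \<omega> in prb S. \<exists>q\<ge>0::rat. R < norm (proc S (of_rat q) \<omega>)"
    and large: "\<And>x. R \<le> norm x \<Longrightarrow> c \<le> measure (P x) B"
    and G: "G \<in> sets (prb S)"
    and shift: "\<And>\<omega> s. \<omega> \<in> space (prb S) \<Longrightarrow> 0 \<le> s \<Longrightarrow> (\<lambda>t\<in>{0..}. proc S (s + t) \<omega>) \<in> B \<Longrightarrow> \<omega> \<in> G"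
  shows "c \<le> measure (prb S) G"
proof -
  interpret prob_space "prb S" by (rule weak_solutionD(1)[OF sol])
  define \<tau> where "\<tau> = exit_time (proc S) R"
  \<comment> \<open>The largest event on which the Markov property is stated. It is admissible since
    it contains each event that \<tau> is at most t, and it has probability 1.\<close>
  define D where "D = {\<omega>\<in>space (prb S). \<tau> \<omega> < \<infinity>}"
  define f where "f \<omega> = measure (P (proc S (real_of_ereal (\<tau> \<omega>)) \<omega>)) B" for \<omega>
  have P: "P \<in> borel \<rightarrow>\<^sub>M prob_algebra path_space"
    using sm unfolding strong_markov_def Let_def by blast
  have [measurable]: "\<tau> \<in> borel_measurable (prb S)"
    unfolding \<tau>_def by (rule measurable_exit_time[OF weak_solutionD(2)[OF sol]])
  have tau0: "0 \<le> \<tau> \<omega>" for \<omega> unfolding \<tau>_def by (rule exit_time_nonneg)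
  have D [measurable]: "D \<in> sets (prb S)" unfolding D_def by measurable
  have AED: "AE \<omega> in prb S. \<omega> \<in> D"
    using exit AE_space by eventually_elim (simp only: D_def \<tau>_def mem_Collect_eq exit_time_finite_iff simp_thms)
  have stop: "{\<omega>\<in>space (prb S). \<tau> \<omega> \<le> ereal t} \<in> natural_events (prb S) (proc S) t" if "0 \<le> t" for t
    unfolding \<tau>_def by (rule exit_time_le_natural_event[OF that])
  have Dstop: "D \<inter> {\<omega>\<in>space (prb S). \<tau> \<omega> \<le> ereal t} = {\<omega>\<in>space (prb S). \<tau> \<omega> \<le> ereal t}" for t
    by (auto simp: D_def)
  have "(\<lambda>\<omega>. proc S (real_of_ereal (\<tau> \<omega>)) \<omega>) \<in> borel_measurable (prb S)"
    by (rule measurable_at_random_time[OF weak_solutionD(2,4)[OF sol]])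
      (auto intro!: real_of_ereal_pos tau0)
  from measurable_compose[OF this measurable_compose[OF P measurable_measure_prob_algebra[OF B]]]
  have f [measurable]: "f \<in> borel_measurable (prb S)" unfolding f_def .
  have f0: "0 \<le> f \<omega>" for \<omega> by (simp add: f_def)
  have f1: "f \<omega> \<le> 1" for \<omega>
  proof -
    have "P (proc S (real_of_ereal (\<tau> \<omega>)) \<omega>) \<in> space (prob_algebra path_space)"
      using measurable_space[OF P] by simp
    then show ?thesis by (auto simp: f_def space_prob_algebra intro: prob_space.prob_le_1)
  qed
  have "\<forall>D\<in>sets (prb S). (\<forall>t\<ge>0. D \<inter> {\<omega>\<in>space (prb S). \<tau> \<omega> \<le> ereal t} \<in> natural_events (prb S) (proc S) t)
      \<and> (\<forall>\<omega>\<in>D. \<tau> \<omega> < \<infinity>) \<longrightarrow> (\<forall>B\<in>sets path_space.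
         measure (prb S) {\<omega>\<in>D. (\<lambda>t\<in>{0..}. proc S (real_of_ereal (\<tau> \<omega>) + t) \<omega>) \<in> B}
           = (LINT \<omega>:D|prb S. measure (P (proc S (real_of_ereal (\<tau> \<omega>)) \<omega>)) B))"
    using sm tau0 stop unfolding strong_markov_def Let_def by blast
  from this[rule_format, OF D _ B]
  have eq: "measure (prb S) {\<omega>\<in>D. (\<lambda>t\<in>{0..}. proc S (real_of_ereal (\<tau> \<omega>) + t) \<omega>) \<in> B} = (LINT \<omega>:D|prb S. f \<omega>)"
    using stop by (auto simp: Dstop f_def) (auto simp: D_def)
  have "c = (LINT \<omega>|prb S. c)" by (simp add: prob_space)
  also have "\<dots> \<le> (LINT \<omega>|prb S. indicator D \<omega> *\<^sub>R f \<omega>)"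
  proof (rule integral_mono_AE)
    show "integrable (prb S) (\<lambda>\<omega>. indicator D \<omega> *\<^sub>R f \<omega>)"
      by (rule integrable_const_bound[of _ 1]) (auto simp: f0 f1 split: split_indicator)
    show "AE \<omega> in prb S. c \<le> indicator D \<omega> *\<^sub>R f \<omega>"
      using AED AE_space
    proof eventually_elim
      case (elim \<omega>)
      have "R \<le> norm (proc S (real_of_ereal (\<tau> \<omega>)) \<omega>)"
        unfolding \<tau>_def
        by (rule norm_at_exit_time[where X = "proc S", OF _ weak_solutionD(4)[OF sol elim(2)]])
          (use elim in \<open>simp_all add: D_def \<tau>_def\<close>)
      then show ?case using elim large by (simp add: f_def)
    qed
  qed simp
  also have "\<dots> = measure (prb S) {\<omega>\<in>D. (\<lambda>t\<in>{0..}. proc S (real_of_ereal (\<tau> \<omega>) + t) \<omega>) \<in> B}"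
    unfolding eq set_lebesgue_integral_def ..
  also have "\<dots> \<le> measure (prb S) G"
  proof (rule finite_measure_mono[OF _ G], rule subsetI)
    fix \<omega> assume "\<omega> \<in> {\<omega>\<in>D. (\<lambda>t\<in>{0..}. proc S (real_of_ereal (\<tau> \<omega>) + t) \<omega>) \<in> B}"
    then show "\<omega> \<in> G" using shift[of \<omega> "real_of_ereal (\<tau> \<omega>)"] tau0[of \<omega>] by (auto simp: D_def real_of_ereal_pos)
  qed
  finally show ?thesis .
qed

section \<open>Almost sure asymptotics of solutions\<close>

text \<open>The limit vector is nonzero, so its norm gives the divergence; \<open>sgn\<close> is
  continuous there and gives the direction; and the error divided by l^p gives the asymptotic
  equivalence.\<close>

lemma scaled_limit_asymptotics:
  fixes w :: "real \<Rightarrow> 'e::real_inner"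
  assumes "l > 0" "p > 0" and \<phi>: "norm \<phi> = 1" and lim: "((\<lambda>t. w t /\<^sub>R t powr p) \<longlongrightarrow> l powr p *\<^sub>R \<phi>) at_top"
  shows "filterlim (\<lambda>t. norm (w t)) at_top at_top"
    "((\<lambda>t. w t /\<^sub>R norm (w t)) \<longlongrightarrow> \<phi>) at_top"
    "vec_asymp w (\<lambda>t. ((l * t) powr p) *\<^sub>R \<phi>)"
proof -
  define c where "c = l powr p"
  have c: "c > 0" using assms by (simp add: c_def)
  have "((\<lambda>t. norm (w t /\<^sub>R t powr p)) \<longlongrightarrow> c) at_top"
    using tendsto_norm[OF lim] \<phi> c by (simp add: c_def)
  moreover have "filterlim (\<lambda>t::real. t powr p) at_top at_top" using assms(2) by real_asymp
  ultimately have "filterlim (\<lambda>t. norm (w t /\<^sub>R t powr p) * t powr p) at_top at_top"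
    using c by (intro filterlim_tendsto_pos_mult_at_top)
  then show "filterlim (\<lambda>t. norm (w t)) at_top at_top"
  proof (rule filterlim_mono_eventually[OF _ order_refl order_refl])
    show "eventually (\<lambda>t. norm (w t /\<^sub>R t powr p) * t powr p = norm (w t)) at_top"
      using eventually_gt_at_top[of 0] by eventually_elim simp
  qed
  have "((\<lambda>t. sgn (w t /\<^sub>R t powr p)) \<longlongrightarrow> sgn (l powr p *\<^sub>R \<phi>)) at_top"
    using c \<phi> by (intro tendsto_sgn lim) (auto simp: c_def)
  moreover have "sgn (l powr p *\<^sub>R \<phi>) = \<phi>"
    using c \<phi> by (simp add: sgn_scaleR c_def sgn_div_norm[of \<phi>])
  ultimately have "((\<lambda>t. sgn (w t /\<^sub>R t powr p)) \<longlongrightarrow> \<phi>) at_top" by simp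
  then show "((\<lambda>t. w t /\<^sub>R norm (w t)) \<longlongrightarrow> \<phi>) at_top"
  proof (rule Lim_transform_eventually)
    show "eventually (\<lambda>t. sgn (w t /\<^sub>R t powr p) = w t /\<^sub>R norm (w t)) at_top"
      using eventually_gt_at_top[of 0] by eventually_elim (simp add: sgn_scaleR sgn_div_norm[of "w _"])
  qed
  have ev: "eventually (\<lambda>t::real. norm ((l * t) powr p *\<^sub>R \<phi>) = t powr p * c \<and> 0 < t powr p) at_top"
    using eventually_gt_at_top[of 0]
    by eventually_elim (use assms in \<open>simp add: powr_mult c_def\<close>)
  have "((\<lambda>t. norm (w t /\<^sub>R t powr p - l powr p *\<^sub>R \<phi>) / c) \<longlongrightarrow> norm (l powr p *\<^sub>R \<phi> - l powr p *\<^sub>R \<phi>) / c) at_top"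
    using c by (intro tendsto_intros lim) auto
  then have quot: "((\<lambda>t. norm (w t /\<^sub>R t powr p - l powr p *\<^sub>R \<phi>) / c) \<longlongrightarrow> 0) at_top" by simp
  show "vec_asymp w (\<lambda>t. ((l * t) powr p) *\<^sub>R \<phi>)"
    unfolding vec_asymp_def
  proof (rule smalloI_tendsto)
    show "((\<lambda>t. norm (w t - (l * t) powr p *\<^sub>R \<phi>) / norm ((l * t) powr p *\<^sub>R \<phi>)) \<longlongrightarrow> 0) at_top"
    proof (rule Lim_transform_eventually[OF quot])
      show "eventually (\<lambda>t. norm (w t /\<^sub>R t powr p - l powr p *\<^sub>R \<phi>) / c
          = norm (w t - (l * t) powr p *\<^sub>R \<phi>) / norm ((l * t) powr p *\<^sub>R \<phi>)) at_top"
        using eventually_gt_at_top[of 0] ev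
      proof eventually_elim
        case (elim t)
        have "w t - (l * t) powr p *\<^sub>R \<phi> = t powr p *\<^sub>R (w t /\<^sub>R t powr p - l powr p *\<^sub>R \<phi>)"
          using elim \<open>l > 0\<close> by (simp add: scaleR_diff_right powr_mult mult.commute)
        then have "norm (w t - (l * t) powr p *\<^sub>R \<phi>) = t powr p * norm (w t /\<^sub>R t powr p - l powr p *\<^sub>R \<phi>)"
          using elim by simp
        then show ?case using elim c by simp
      qed
    qed
    show "eventually (\<lambda>t. norm ((l * t) powr p *\<^sub>R \<phi>) \<noteq> 0) at_top"
      using ev by eventually_elim (use c in auto)
  qed
qed

text \<open>Passes from the Lebesgue integral of the drift to the gauge integral in which the
  trajectory lemmas are phrased.\<close>

lemma weak_solution_pathwise:
  assumes "weak_solution E S"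
  obtains \<xi> where "noise_part E S \<xi>"
    "AE \<omega> in prb S. \<forall>t\<ge>0. (\<lambda>s. drift E (proc S s \<omega>)) integrable_on {0..t} \<and>
       proc S t \<omega> = proc S 0 \<omega> + integral {0..t} (\<lambda>s. drift E (proc S s \<omega>)) + \<xi> t \<omega>"
proof -
  obtain \<xi> where \<xi>: "noise_part E S \<xi>" "AE \<omega> in prb S. \<forall>t\<ge>0.
           set_integrable lborel {0..t} (\<lambda>s. drift E (proc S s \<omega>)) \<and>
           proc S t \<omega> = proc S 0 \<omega> + (LINT s:{0..t}|lborel. drift E (proc S s \<omega>)) + \<xi> t \<omega>"
    using assms unfolding weak_solution_def by blast
  from \<xi>(2) have "AE \<omega> in prb S. \<forall>t\<ge>0. (\<lambda>s. drift E (proc S s \<omega>)) integrable_on {0..t} \<and>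
       proc S t \<omega> = proc S 0 \<omega> + integral {0..t} (\<lambda>s. drift E (proc S s \<omega>)) + \<xi> t \<omega>"
    by eventually_elim (metis set_borel_integral_eq_integral)
  with \<xi>(1) show ?thesis by (rule that)
qed

context radial_drift
begin

text \<open>The candidates for the limit of X(t)/t^p, one for each direction. As a continuous image
  of the sphere the set is closed, which \<open>scaled_limit_in_tendsto\<close> requires.\<close>

definition limit_set :: "'e set" where
  "limit_set = (\<lambda>\<phi>. ((1 - \<beta>) * abar \<phi>) powr (1 / (1 - \<beta>)) *\<^sub>R \<phi>) ` sphere 0 1"

lemma closed_limit_set: "closed limit_set" and limit_set_nonempty: "limit_set \<noteq> {}"
proof -
  have "continuous_on (sphere 0 1) (\<lambda>\<phi>. ((1 - \<beta>) * abar \<phi>) powr (1 / (1 - \<beta>)) *\<^sub>R \<phi>)"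
    using beta by (intro continuous_intros abar_cont) (auto dest!: abar_pos)
  then show "closed limit_set"
    unfolding limit_set_def by (intro compact_imp_closed compact_continuous_image compact_sphere)
  show "limit_set \<noteq> {}" by (simp add: limit_set_def)
qed

text \<open>\<open>trajectory_limit\<close> for the path restarted at time \<open>T\<close>: there x
  t = X (T + t), y consists of X T and the drift accumulated since T, and the perturbation is the
  increment of the noise. A free T permits a restart at a more favourable time than 0.\<close>

lemma path_limit:
  assumes "0 \<le> K" "0 \<le> q" "q < 1 / (1 - \<beta>)"
  obtains R where "R > 0"
    "\<And>X \<xi> T. 0 \<le> T \<Longrightarrow> R \<le> norm (X T) \<Longrightarrow>
      \<forall>t\<ge>0. (\<lambda>s. A (X s)) integrable_on {0..t} \<and> X t = X 0 + integral {0..t} (\<lambda>s. A (X s)) + \<xi> t \<Longrightarrow>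
      \<forall>t\<ge>0. norm (\<xi> (T + t) - \<xi> T) \<le> K * (1 + t) powr q \<Longrightarrow>
      scaled_limit_in (1 / (1 - \<beta>)) limit_set X"
proof -
  obtain R where R: "R > 0"
    "\<And>x y. norm (y 0) \<ge> R \<Longrightarrow> \<forall>t\<ge>0. norm (x t - y t) \<le> K * (1 + t) powr q \<Longrightarrow>
      \<forall>s\<ge>0. \<forall>t\<ge>s. ((\<lambda>r. A (x r)) has_integral (y t - y s)) {s..t} \<Longrightarrow>
      \<exists>\<phi>\<in>sphere 0 1. ((\<lambda>t. x t /\<^sub>R t powr (1 / (1 - \<beta>)))
         \<longlongrightarrow> ((1 - \<beta>) * abar \<phi>) powr (1 / (1 - \<beta>)) *\<^sub>R \<phi>) at_top"
    by (rule trajectory_limit[OF assms]) blast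
  show ?thesis
  proof (rule that[OF R(1)])
    fix X \<xi> :: "real \<Rightarrow> 'e" and T :: real
    assume T: "0 \<le> T" "R \<le> norm (X T)"
      and X: "\<forall>t\<ge>0. (\<lambda>s. A (X s)) integrable_on {0..t} \<and> X t = X 0 + integral {0..t} (\<lambda>s. A (X s)) + \<xi> t"
      and \<xi>: "\<forall>t\<ge>0. norm (\<xi> (T + t) - \<xi> T) \<le> K * (1 + t) powr q"
    define f where "f s = A (X s)" for s
    have int: "f integrable_on {s..t}" if "0 \<le> s" for s t
    proof (cases "0 \<le> t")
      case True
      have "f integrable_on {0..t}" using X True unfolding f_def[abs_def] by blast
      then show ?thesis by (rule integrable_on_subinterval) (use that in auto)
    next
      case False
      then show ?thesis using that by (simp add: integrable_on_empty)
    qed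
    have comb: "integral {s..t} f + integral {t..u} f = integral {s..u} f" if "0 \<le> s" "s \<le> t" "t \<le> u" for s t u
      using that by (intro Henstock_Kurzweil_Integration.integral_combine int) auto
    define y where "y t = X T + integral {T..T + t} f" for t
    have "\<exists>\<phi>\<in>sphere 0 1. ((\<lambda>t. X (T + t) /\<^sub>R t powr (1 / (1 - \<beta>)))
         \<longlongrightarrow> ((1 - \<beta>) * abar \<phi>) powr (1 / (1 - \<beta>)) *\<^sub>R \<phi>) at_top"
    proof (rule R(2)[of y]; (intro allI impI)?)
      show "R \<le> norm (y 0)" using T by (simp add: y_def)
    next
      fix t :: real assume t: "0 \<le> t"
      have eq: "X u = X 0 + integral {0..u} f + \<xi> u" if "0 \<le> u" for u
        using X that unfolding f_def[abs_def] by blast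
      have "X (T + t) - y t = \<xi> (T + t) - \<xi> T"
        unfolding y_def using comb[of 0 T "T + t"] eq[of T] eq[of "T + t"] t T(1)
        by (simp add: algebra_simps)
      then show "norm (X (T + t) - y t) \<le> K * (1 + t) powr q" using \<xi> t by simp
    next
      fix s t :: real assume st: "0 \<le> s" "s \<le> t"
      have "y t - y s = integral {T + s..T + t} f"
        using comb[of T "T + s" "T + t"] st T(1) by (simp add: y_def algebra_simps)
      then have "(f has_integral (y t - y s)) (cbox (T + s) (T + t))"
        using int[of "T + s" "T + t"] st T(1) by (simp add: has_integral_integral)
      from has_integral_affinity[OF this, of 1 T]
      show "((\<lambda>r. A (X (T + r))) has_integral (y t - y s)) {s..t}"
        by (simp add: f_def add.commute)
    qed
    then obtain \<phi> where \<phi>: "\<phi> \<in> sphere 0 1" "((\<lambda>t. X (T + t) /\<^sub>R t powr (1 / (1 - \<beta>)))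
         \<longlongrightarrow> ((1 - \<beta>) * abar \<phi>) powr (1 / (1 - \<beta>)) *\<^sub>R \<phi>) at_top" by blast
    show "scaled_limit_in (1 / (1 - \<beta>)) limit_set X"
    proof (rule scaled_limit_in_if_tendsto[OF _ tendsto_scaled_shift[OF \<phi>(2)]])
      show "((1 - \<beta>) * abar \<phi>) powr (1 / (1 - \<beta>)) *\<^sub>R \<phi> \<in> limit_set"
        unfolding limit_set_def using \<phi>(1) by (rule imageI)
    qed
  qed
qed

end

text \<open>A right-continuous path confined to a closed ball at all rational times is confined at
  all times. Rational times turn the statement into an event on path space.\<close>

lemma solution_leaves_balls:
  assumes sol: "weak_solution E S" and sup: "AE \<omega> in prb S. (SUP t\<in>{0..}. ereal (norm (proc S t \<omega>))) = \<infinity>"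
  shows "AE \<omega> in prb S. \<forall>R. \<exists>q\<ge>0::rat. R < norm (proc S (of_rat q) \<omega>)"
  using sup AE_space
proof eventually_elim
  case (elim \<omega>)
  show ?case
  proof
    fix R
    have "ereal R < (SUP t\<in>{0..}. ereal (norm (proc S t \<omega>)))" using elim by simp
    then obtain t where t: "0 \<le> t" "R < norm (proc S t \<omega>)" unfolding less_SUP_iff by auto
    show "\<exists>q\<ge>0::rat. R < norm (proc S (of_rat q) \<omega>)"
    proof (rule ccontr)
      assume neg: "\<not> ?thesis"
      have "proc S t \<omega> \<in> cball 0 R"
      proof (rule right_continuous_rat_closed[OF closed_cball weak_solutionD(4)[OF sol elim(2) t(1)]])
        fix r :: rat assume "t < of_rat r"
        then have "0 \<le> r" using t(1) by (metis order_trans less_imp_le zero_le_of_rat_iff)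
        then show "proc S (of_rat r) \<omega> \<in> cball 0 R" using neg by force
      qed
      with t show False by simp
    qed
  qed
qed

theorem theorem2p2:
  fixes E :: "('d::finite, 'm::finite, 'u) sde"
    and P :: "real ^ 'd \<Rightarrow> (real \<Rightarrow> real ^ 'd) measure"
    and a abar :: "real ^ 'd \<Rightarrow> real"
    and \<beta> :: real
    and S0 :: "('w, 'd, 'm, 'u) sde_system"
  assumes wf: "wf_sde E"
    and well_posed: "weakly_well_posed TYPE('w) E P"
    and markov: "\<And>x (S :: ('w, 'd, 'm, 'u) sde_system). weak_solution E S \<Longrightarrow> starts_at S x \<Longrightarrow> strong_markov P S"
    and beta: "\<beta> < 1"
    and radial: "\<And>x. rad_part (drift E) x = (a x * norm x powr \<beta>) *\<^sub>R sgn x"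
    and radial_limit: "\<And>\<phi>0. \<phi>0 \<in> sphere 0 1 \<Longrightarrow>
          (a \<longlongrightarrow> abar \<phi>0) (inf (filtercomap norm at_top) (filtercomap sgn (nhds \<phi>0)))"
    and abar_cont: "continuous_on (sphere 0 1) abar"
    and abar_pos: "\<And>\<phi>0. \<phi>0 \<in> sphere 0 1 \<Longrightarrow> abar \<phi>0 > 0"
    and tangential: "\<exists>\<gamma>>0. \<exists>C_tan>0. \<exists>R_tan>0. \<forall>r>R_tan.
          (SUP y\<in>sphere 0 r. ereal (norm (tan_part (drift E) y))) \<le> ereal (C_tan * r powr (\<beta> - \<gamma>))"
    and unbounded: "\<And>x (S :: ('w, 'd, 'm, 'u) sde_system). weak_solution E S \<Longrightarrow> starts_at S x \<Longrightarrow>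
          (AE \<omega> in prb S. (SUP t\<in>{0..}. ereal (norm (proc S t \<omega>))) = \<infinity>)"
    and noise_growth: "\<exists>\<delta>>0. \<forall>\<epsilon>>0. \<exists>c. \<forall>x (S :: ('w, 'd, 'm, 'u) sde_system) \<xi>.
          weak_solution E S \<and> starts_at S x \<and> noise_part E S \<xi> \<longrightarrow>
          measure (prb S) {\<omega>\<in>space (prb S). \<forall>t\<ge>0.
              norm (\<xi> t \<omega>) \<le> c * (1 + t powr (1 / (1 - \<beta>) - \<delta>))} \<ge> 1 - \<epsilon>"
    and solution: "weak_solution E S0"
    and initial: "(\<exists>x. starts_at S0 x) \<or> strong_markov P S0"
  shows "(AE \<omega> in prb S0. filterlim (\<lambda>t. norm (proc S0 t \<omega>)) at_top at_top) \<and>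
         (\<exists>\<Phi> \<in> borel_measurable (prb S0).
           (AE \<omega> in prb S0. ((\<lambda>t. proc S0 t \<omega> /\<^sub>R norm (proc S0 t \<omega>)) \<longlongrightarrow> \<Phi> \<omega>) at_top) \<and>
           (AE \<omega> in prb S0. vec_asymp (\<lambda>t. proc S0 t \<omega>)
              (\<lambda>t. (((1 - \<beta>) * abar (\<Phi> \<omega>) * t) powr (1 / (1 - \<beta>))) *\<^sub>R \<Phi> \<omega>)))"
proof -
  obtain \<gamma> C\<^sub>0 R\<^sub>0 where \<gamma>: "\<gamma> > 0" and tan: "\<And>r. r > R\<^sub>0 \<Longrightarrow>
      (SUP y\<in>sphere 0 r. ereal (norm (tan_part (drift E) y))) \<le> ereal (C\<^sub>0 * r powr (\<beta> - \<gamma>))"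
    using tangential by blast
  interpret radial_drift "drift E" a abar \<beta> \<gamma> C\<^sub>0 R\<^sub>0
  proof
    fix x :: "real ^ 'd" assume "norm x > R\<^sub>0"
    have "ereal (norm (tan_part (drift E) x)) \<le> (SUP y\<in>sphere 0 (norm x). ereal (norm (tan_part (drift E) y)))"
      by (rule SUP_upper) simp
    also note tan[OF \<open>norm x > R\<^sub>0\<close>]
    finally show "norm (tan_part (drift E) x) \<le> C\<^sub>0 * norm x powr (\<beta> - \<gamma>)" by simp
  qed (fact beta radial radial_limit abar_cont abar_pos \<gamma>)+
  define p where "p = 1 / (1 - \<beta>)"
  have p: "p > 0" using beta by (simp add: p_def)
  obtain \<delta> where \<delta>: "\<delta> > 0" and noise: "\<And>\<epsilon>. \<epsilon> > 0 \<Longrightarrow> \<exists>c. \<forall>x (S :: ('w, 'd, 'm, 'u) sde_system) \<xi>.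
          weak_solution E S \<and> starts_at S x \<and> noise_part E S \<xi> \<longrightarrow>
          measure (prb S) {\<omega>\<in>space (prb S). \<forall>t\<ge>0. norm (\<xi> t \<omega>) \<le> c * (1 + t powr (p - \<delta>))} \<ge> 1 - \<epsilon>"
    using noise_growth unfolding p_def by blast
  define B where "B = {w\<in>space path_space. scaled_limit_in p limit_set w}"
  have B: "B \<in> sets path_space" unfolding B_def by (rule scaled_limit_in_sets)
  have path_in_B: "(\<lambda>t\<in>{0..}. w t) \<in> B \<longleftrightarrow> scaled_limit_in p limit_set w" for w :: "real \<Rightarrow> real ^ 'd"
    by (auto simp: B_def path_space_def space_PiM)
  have law: "\<exists>S :: ('w, 'd, 'm, 'u) sde_system. weak_solution E S \<and> starts_at S x \<and> path_law S = P x" for x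
    using well_posed unfolding weakly_well_posed_def by blast
  have sm: "strong_markov P S0"
    using initial markov[OF solution] by blast

  \<comment> \<open>Growth of the noise is assumed for solutions on a sample space, while the Markov
    property speaks of P x. The two are joined by taking some solution from x: up to a null set, its
    noise bound forces its path into B, and its path law is P x.\<close>
  have far: "\<exists>R. \<forall>x. R \<le> norm x \<longrightarrow> 1 - \<epsilon> \<le> measure (P x) B" if \<epsilon>: "0 < \<epsilon>" "\<epsilon> < 1" for \<epsilon>
  proof -
    define q where "q = p - \<delta>"
    obtain c where c: "\<And>x (S :: ('w, 'd, 'm, 'u) sde_system) \<xi>. weak_solution E S \<Longrightarrow> starts_at S x \<Longrightarrow> noise_part E S \<xi> \<Longrightarrow>
          measure (prb S) {\<omega>\<in>space (prb S). \<forall>t\<ge>0. norm (\<xi> t \<omega>) \<le> c * (1 + t powr q)} \<ge> 1 - \<epsilon>"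
      using noise[OF \<epsilon>(1)] unfolding q_def by blast
    \<comment> \<open>For large \<delta> the exponent p - \<delta> is negative, so it is raised to
      0, which is still below p. The constant 4 |c| covers the difference of two noise values, each
      at most 2 |c|, in the case q \<le> 0; for q > 0 it is more than enough.\<close>
    have q: "0 \<le> 4 * \<bar>c\<bar>" "0 \<le> max q 0" "max q 0 < 1 / (1 - \<beta>)" using p \<delta> by (auto simp: q_def p_def)
    obtain R where R: "R > 0"
      "\<And>X \<xi> T. 0 \<le> T \<Longrightarrow> R \<le> norm (X T) \<Longrightarrow>
        \<forall>t\<ge>0. (\<lambda>s. drift E (X s)) integrable_on {0..t} \<and> X t = X 0 + integral {0..t} (\<lambda>s. drift E (X s)) + \<xi> t \<Longrightarrow>
        \<forall>t\<ge>0. norm (\<xi> (T + t) - \<xi> T) \<le> (4 * \<bar>c\<bar>) * (1 + t) powr max q 0 \<Longrightarrow>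
        scaled_limit_in p limit_set X"
      unfolding p_def by (rule path_limit[OF q]) blast
    have "1 - \<epsilon> \<le> measure (P x) B" if x: "R \<le> norm x" for x
    proof -
      obtain S :: "('w, 'd, 'm, 'u) sde_system"
        where S: "weak_solution E S" "starts_at S x" "path_law S = P x" using law by blast
      interpret prob_space "prb S" by (rule weak_solutionD(1)[OF S(1)])
      obtain \<xi> where \<xi>: "noise_part E S \<xi>"
        "AE \<omega> in prb S. \<forall>t\<ge>0. (\<lambda>s. drift E (proc S s \<omega>)) integrable_on {0..t} \<and>
           proc S t \<omega> = proc S 0 \<omega> + integral {0..t} (\<lambda>s. drift E (proc S s \<omega>)) + \<xi> t \<omega>"
        by (rule weak_solution_pathwise[OF S(1)])
      define N where "N = {\<omega>\<in>space (prb S). \<forall>t\<ge>0. norm (\<xi> t \<omega>) \<le> c * (1 + t powr q)}"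
      define Q where "Q = {\<omega>\<in>space (prb S). (\<lambda>t\<in>{0..}. proc S t \<omega>) \<in> B}"
      have Q: "Q \<in> sets (prb S)"
        unfolding Q_def using measurable_sets[OF measurable_path[OF weak_solutionD(2)[OF S(1)]] B]
        by (simp add: vimage_def Int_def conj_commute)
      have "AE \<omega> in prb S. \<omega> \<in> N \<longrightarrow> \<omega> \<in> Q"
        using \<xi>(2) solution_leaves_balls[OF S(1) unbounded[OF S(1,2)]] S(2)[unfolded starts_at_def] AE_space
      proof eventually_elim
        case (elim \<omega>)
        show ?case
        proof
          assume \<omega>N: "\<omega> \<in> N"
          define X \<zeta> where "X t = proc S t \<omega>" and "\<zeta> t = \<xi> t \<omega>" for t
          have eq: "\<forall>t\<ge>0. (\<lambda>s. drift E (X s)) integrable_on {0..t} \<and> X t = X 0 + integral {0..t} (\<lambda>s. drift E (X s)) + \<zeta> t"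
            unfolding X_def \<zeta>_def by (rule elim(1))
          have \<zeta>0: "\<zeta> 0 = 0" using eq[rule_format, of 0] by simp
          have \<zeta>: "norm (\<zeta> t) \<le> \<bar>c\<bar> * (1 + t powr q)" if "0 \<le> t" for t
          proof -
            have "norm (\<zeta> t) \<le> c * (1 + t powr q)" using \<omega>N that by (simp add: N_def \<zeta>_def)
            also have "\<dots> \<le> \<bar>c\<bar> * (1 + t powr q)" by (intro mult_right_mono) auto
            finally show ?thesis .
          qed
          have "\<exists>T\<ge>0. R \<le> norm (X T) \<and> (\<forall>t\<ge>0. norm (\<zeta> (T + t) - \<zeta> T) \<le> (4 * \<bar>c\<bar>) * (1 + t) powr max q 0)"
          proof (cases "q > 0")
            case True
            have "norm (\<zeta> t) \<le> (4 * \<bar>c\<bar>) * (1 + t) powr q" if "0 \<le> t" for t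
            proof -
              have "1 \<le> (1 + t) powr q" "t powr q \<le> (1 + t) powr q"
                using that True by (auto intro: ge_one_powr_ge_zero powr_mono2)
              then have "1 + t powr q \<le> 4 * (1 + t) powr q" by linarith
              then have "\<bar>c\<bar> * (1 + t powr q) \<le> \<bar>c\<bar> * (4 * (1 + t) powr q)" by (rule mult_left_mono) simp
              with \<zeta>[OF that] show ?thesis by simp
            qed
            then show ?thesis
              using True x elim(3) \<zeta>0 by (intro exI[of _ 0]) (simp add: X_def)
          next
            case False
            \<comment> \<open>For \<open>q < 0\<close> the bound on the noise is void near \<open>t = 0\<close>. But the noise is bounded by a constant
              from time 1 on, so any later far away point of the path will do as a new start.\<close>
            have \<zeta>1: "norm (\<zeta> t) \<le> 2 * \<bar>c\<bar>" if "1 \<le> t" for t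
            proof -
              have "t powr q \<le> t powr 0" using False that by (intro powr_mono) auto
              then have "1 + t powr q \<le> 2" using that by simp
              then have "\<bar>c\<bar> * (1 + t powr q) \<le> \<bar>c\<bar> * 2" by (rule mult_left_mono) simp
              with \<zeta>[of t] that show ?thesis by simp
            qed
            have "cadlag X" unfolding X_def by (rule weak_solutionD(3)[OF S(1) elim(4)])
            then have "bounded (X ` {0..1})" by (rule cadlag_bounded_Icc)
            then obtain b where b: "\<And>t. 0 \<le> t \<Longrightarrow> t \<le> 1 \<Longrightarrow> norm (X t) \<le> b"
              unfolding bounded_iff by (metis atLeastAtMost_iff image_eqI)
            \<comment> \<open>Exceeding the bound b of the path on [0, 1] forces this time beyond 1,
              where the constant bound on the noise holds; exceeding R makes the point a far
              one.\<close>
            obtain r :: rat where r: "0 \<le> r" "max b R < norm (X (of_rat r))"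
              using elim(2) unfolding X_def by blast
            then have r0: "(0::real) \<le> of_rat r" by (simp add: zero_le_of_rat_iff)
            with r b[of "of_rat r"] have r1: "(1::real) \<le> of_rat r" by force
            have "norm (\<zeta> (of_rat r + t) - \<zeta> (of_rat r)) \<le> (4 * \<bar>c\<bar>) * (1 + t) powr max q 0" if "0 \<le> t" for t
              using \<zeta>1[of "of_rat r + t"] \<zeta>1[OF r1] r1 that False
                norm_triangle_ineq4[of "\<zeta> (of_rat r + t)" "\<zeta> (of_rat r)"] by simp
            then show ?thesis using r r0 by (intro exI[of _ "of_rat r"]) auto
          qed
          then have "scaled_limit_in p limit_set X" using R(2)[OF _ _ eq] by blast
          then show "\<omega> \<in> Q" using elim(4) by (simp add: Q_def path_in_B X_def[abs_def])
        qed
      qed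
      then have "measure (prb S) N \<le> measure (prb S) Q" by (rule finite_measure_mono_AE[OF _ Q])
      with c[OF S(1,2) \<xi>(1)] have "1 - \<epsilon> \<le> measure (prb S) Q" unfolding N_def by linarith
      then show ?thesis unfolding S(3)[symmetric] measure_path_law[OF S(1) B] Q_def .
    qed
    then show ?thesis by blast
  qed

  interpret prob_space "prb S0" by (rule weak_solutionD(1)[OF solution])
  \<comment> \<open>Unboundedness is assumed for deterministic starting points only, whereas S0 may
    start at random. Hence the detour through the laws P x and the Markov property at time
    0.\<close>
  have leave: "AE \<omega> in prb S0. \<exists>q\<ge>0::rat. R < norm (proc S0 (of_rat q) \<omega>)" for R
  proof -
    define U where "U = {w\<in>space path_space. \<exists>q\<in>{0::rat..}. R < norm (w (of_rat q) :: real ^ 'd)}"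
    have U: "U \<in> sets path_space"
    proof -
      have "{w\<in>space path_space. R < norm (w (of_rat q) :: real ^ 'd)} \<in> sets path_space" if "q \<in> {0..}" for q :: rat
      proof -
        have [measurable]: "(\<lambda>w. w (of_rat q) :: real ^ 'd) \<in> borel_measurable path_space"
          using that by (intro path_space_component) (simp add: zero_le_of_rat_iff)
        show ?thesis by measurable
      qed
      then have "(\<Union>q\<in>{0::rat..}. {w\<in>space path_space. R < norm (w (of_rat q) :: real ^ 'd)}) \<in> sets path_space"
        by (intro sets.countable_UN'') auto
      also have "(\<Union>q\<in>{0::rat..}. {w\<in>space path_space. R < norm (w (of_rat q) :: real ^ 'd)}) = U"
        by (auto simp: U_def)
      finally show ?thesis .
    qed
    have path_in_U: "(\<lambda>t\<in>{0..}. w t) \<in> U \<longleftrightarrow> (\<exists>q\<ge>0::rat. R < norm (w (of_rat q)))" for w :: "real \<Rightarrow> real ^ 'd"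
      by (auto simp: U_def path_space_def space_PiM zero_le_of_rat_iff)
    have "measure (P x) U = 1" for x
    proof -
      obtain S :: "('w, 'd, 'm, 'u) sde_system"
        where S: "weak_solution E S" "starts_at S x" "path_law S = P x" using law by blast
      interpret S: prob_space "prb S" by (rule weak_solutionD(1)[OF S(1)])
      have "AE \<omega> in prb S. (\<lambda>t\<in>{0..}. proc S t \<omega>) \<in> U"
        using solution_leaves_balls[OF S(1) unbounded[OF S(1,2)]] by eventually_elim (simp add: path_in_U)
      moreover have "{\<omega>\<in>space (prb S). (\<lambda>t\<in>{0..}. proc S t \<omega>) \<in> U} \<in> sets (prb S)"
        using measurable_sets[OF measurable_path[OF weak_solutionD(2)[OF S(1)]] U]
        by (simp add: vimage_def Int_def conj_commute)
      ultimately show ?thesis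
        unfolding S(3)[symmetric] measure_path_law[OF S(1) U] by (simp add: S.prob_Collect_eq_1)
    qed
    from strong_markov_at_start[OF solution sm U this] show ?thesis
      by eventually_elim (simp add: path_in_U)
  qed

  define G where "G = {\<omega>\<in>space (prb S0). scaled_limit_in p limit_set (\<lambda>t. proc S0 t \<omega>)}"
  have G: "G \<in> sets (prb S0)"
    using measurable_sets[OF measurable_path[OF weak_solutionD(2)[OF solution]] B]
    by (simp add: vimage_def Int_def conj_commute path_in_B G_def)
  have shift: "\<omega> \<in> G" if \<omega>: "\<omega> \<in> space (prb S0)" and "0 \<le> s" and shifted: "(\<lambda>t\<in>{0..}. proc S0 (s + t) \<omega>) \<in> B" for \<omega> s
  proof -
    have right: "((\<lambda>u. proc S0 (s + u) \<omega>) \<longlongrightarrow> proc S0 (s + t) \<omega>) (at_right t)" if "0 \<le> t" for t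
    proof -
      have "((\<lambda>u. proc S0 u \<omega>) \<longlongrightarrow> proc S0 (s + t) \<omega>) (at_right (s + t))"
        using that \<open>0 \<le> s\<close> by (intro weak_solutionD(4)[OF solution \<omega>]) simp
      then show ?thesis
        by (simp add: at_right_to_0[of "s + t"] at_right_to_0[of t] filterlim_filtermap ac_simps)
    qed
    \<comment> \<open>The shift by a real s does not preserve the rational times of
      \<open>scaled_limit_in\<close>, so the argument passes through a genuine limit over real
      times, which does not depend on the shift.\<close>
    obtain L where L: "L \<in> limit_set" "((\<lambda>t. proc S0 (s + t) \<omega> /\<^sub>R t powr p) \<longlongrightarrow> L) at_top"
      by (rule scaled_limit_in_tendsto[OF shifted[unfolded path_in_B] closed_limit_set limit_set_nonempty right])
    from scaled_limit_in_if_tendsto[OF L(1) tendsto_scaled_shift[OF L(2)]]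
    show ?thesis using \<omega> by (simp add: G_def)
  qed
  have near: "1 - \<epsilon> \<le> measure (prb S0) G" if \<epsilon>: "0 < \<epsilon>" "\<epsilon> < 1" for \<epsilon>
  proof -
    obtain R where "\<And>x. R \<le> norm x \<Longrightarrow> 1 - \<epsilon> \<le> measure (P x) B" using far[OF \<epsilon>] by blast
    from strong_markov_at_exit[OF solution sm B leave this G shift] show ?thesis .
  qed
  have "1 \<le> measure (prb S0) G"
  proof (rule ccontr)
    assume "\<not> ?thesis"
    with near[of "(1 - measure (prb S0) G) / 2"] measure_nonneg[of "prb S0" G] show False
      by (simp add: field_simps)
  qed
  then have "measure (prb S0) G = 1" using prob_le_1[of G] by linarith
  then have AEG: "AE \<omega> in prb S0. \<omega> \<in> G" by (rule AE_prob_1)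

  \<comment> \<open>A limit along integers of measurable maps is measurable on the whole space,
    including the null set where the direction need not converge; on G it is the limit over real
    times.\<close>
  define \<Phi> where "\<Phi> \<omega> = lim (\<lambda>n. sgn (proc S0 (real n) \<omega>))" for \<omega>
  have "\<Phi> \<in> borel_measurable (prb S0)"
  proof -
    have [measurable]: "proc S0 (real n) \<in> borel_measurable (prb S0)" for n
      by (rule weak_solutionD(2)[OF solution]) simp
    have "(\<lambda>\<omega>. sgn (proc S0 (real n) \<omega>)) \<in> borel_measurable (prb S0)" for n
      unfolding sgn_div_norm by measurable
    then show ?thesis unfolding \<Phi>_def[abs_def] by (rule borel_measurable_lim_metric)
  qed
  moreover have "AE \<omega> in prb S0. filterlim (\<lambda>t. norm (proc S0 t \<omega>)) at_top at_top \<and>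
      ((\<lambda>t. proc S0 t \<omega> /\<^sub>R norm (proc S0 t \<omega>)) \<longlongrightarrow> \<Phi> \<omega>) at_top \<and>
      vec_asymp (\<lambda>t. proc S0 t \<omega>) (\<lambda>t. (((1 - \<beta>) * abar (\<Phi> \<omega>) * t) powr (1 / (1 - \<beta>))) *\<^sub>R \<Phi> \<omega>)"
    using AEG
  proof eventually_elim
    case (elim \<omega>)
    then have \<omega>: "\<omega> \<in> space (prb S0)" and lim: "scaled_limit_in p limit_set (\<lambda>t. proc S0 t \<omega>)"
      by (auto simp: G_def)
    obtain L where L: "L \<in> limit_set" "((\<lambda>t. proc S0 t \<omega> /\<^sub>R t powr p) \<longlongrightarrow> L) at_top"
      by (rule scaled_limit_in_tendsto[OF lim closed_limit_set limit_set_nonempty weak_solutionD(4)[OF solution \<omega>]])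
    from L(1) obtain \<phi> where \<phi>1: "\<phi> \<in> sphere 0 1" "L = ((1 - \<beta>) * abar \<phi>) powr p *\<^sub>R \<phi>"
      unfolding limit_set_def p_def by (elim imageE)
    note \<phi> = \<phi>1(1) L(2)[unfolded \<phi>1(2)]
    have l: "0 < (1 - \<beta>) * abar \<phi>" using abar_pos[OF \<phi>(1)] beta by simp
    note as = scaled_limit_asymptotics[OF l p _ \<phi>(2)]
    have dir: "((\<lambda>t. proc S0 t \<omega> /\<^sub>R norm (proc S0 t \<omega>)) \<longlongrightarrow> \<phi>) at_top" using as(2) \<phi>(1) by simp
    have "(\<lambda>n. sgn (proc S0 (real n) \<omega>)) \<longlonglongrightarrow> \<phi>"
      using filterlim_compose[OF dir filterlim_real_sequentially] by (simp add: sgn_div_norm)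
    then have "\<Phi> \<omega> = \<phi>" unfolding \<Phi>_def by (rule limI)
    with as dir \<phi>(1) show ?case by (simp add: p_def)
  qed
  ultimately show ?thesis by (auto simp: AE_conj_iff)
qed

end
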